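(* For every integer $n\ge2$ there exists a constant $C_{n-2}$, depending only on $n$, such that for every integer $t\ge1$ and every integer $N>C_{n-2}\,t^{n-2}$ there exists a spherical design of harmonic index $t$ on $S^{n-1}$ of size $N$.
   Context: $S^{n-1}$ denotes the unit sphere centered at the origin in $\mathbb{R}^n$. The constant $C_{n-2}$ is positive. $\mathrm{Harm}_t(\mathbb{R}^n)$ is the space of real homogeneous polynomials $f$ of degree $t$ in $n$ variables with $\Delta f=0$, where $\Delta=\sum_i\partial^2/\partial x_i^2$. A finite nonempty subset $X\subset S^{n-1}$ (a set of distinct points) is a spherical design of harmonic index $t$ if $\sum_{x\in X}f(x)=0$ for every $f\in\mathrm{Harm}_t(\mathbb{R}^n)$. *)

theory Defs
  imports "HOL-Analysis.Analysis"
begin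

text \<open>
  Real polynomials in \<open>n\<close> variables are identified with the polynomial functions they induce on
  \<open>\<real>\<^sup>n\<close>, here \<^typ>\<open>real ^ 'n\<close> with \<open>n = CARD('n)\<close>; over the reals this identification is faithful.
  A function \<open>\<alpha> :: 'n \<Rightarrow> nat\<close> is the exponent vector of a monomial.  The sum below ranges over the
  exponent vectors of total degree \<open>t\<close>, a finite set by the lemma that follows.
\<close>

definition homogeneous_polynomial :: "nat \<Rightarrow> (real ^ 'n \<Rightarrow> real) \<Rightarrow> bool" where
  "homogeneous_polynomial t f \<longleftrightarrow>
     (\<exists>c :: ('n \<Rightarrow> nat) \<Rightarrow> real. \<forall>x.
        f x = (\<Sum>\<alpha> | (\<Sum>i\<in>UNIV. \<alpha> i) = t. c \<alpha> * (\<Prod>i\<in>UNIV. (x $ i) ^ \<alpha> i)))"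

lemma finite_exponents: "finite {\<alpha> :: 'n::finite \<Rightarrow> nat. (\<Sum>i\<in>UNIV. \<alpha> i) = t}"
proof (rule finite_subset)
  show "{\<alpha> :: 'n \<Rightarrow> nat. (\<Sum>i\<in>UNIV. \<alpha> i) = t} \<subseteq> UNIV \<rightarrow>\<^sub>E {..t}"
    by (auto intro!: member_le_sum)
  show "finite ((UNIV :: 'n set) \<rightarrow>\<^sub>E {..t})"
    by (intro finite_PiE) auto
qed

definition partial_deriv :: "'n \<Rightarrow> (real ^ 'n \<Rightarrow> real) \<Rightarrow> real ^ 'n \<Rightarrow> real" where
  "partial_deriv i f x = deriv (\<lambda>s. f (x + s *\<^sub>R axis i 1)) 0"

definition laplacian :: "(real ^ 'n \<Rightarrow> real) \<Rightarrow> real ^ 'n \<Rightarrow> real" where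
  "laplacian f x = (\<Sum>i\<in>UNIV. partial_deriv i (partial_deriv i f) x)"

definition Harm :: "nat \<Rightarrow> (real ^ 'n \<Rightarrow> real) set" where
  "Harm t = {f. homogeneous_polynomial t f \<and> (\<forall>x. laplacian f x = 0)}"

definition harmonic_index_design :: "nat \<Rightarrow> (real ^ 'n) set \<Rightarrow> bool" where
  "harmonic_index_design t X \<longleftrightarrow>
     finite X \<and> X \<noteq> {} \<and> X \<subseteq> sphere 0 1 \<and> (\<forall>f\<in>Harm t. (\<Sum>x\<in>X. f x) = 0)"

end

theory Submission
  imports Defs "HOL-Homology.Homology"
begin

text \<open>
  If a harmonic homogeneous polynomial of degree \<open>t\<close> is at most \<open>b\<close> on the sphere, then it is at least
  \<open>- K * b\<close> there, with \<open>K\<close> depending only on the dimension: compare \<open>f p = - A\<close> with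
  \<open>f ((1 + \<rho>) *\<^sub>R p) = - (1 + \<rho>) ^ t * A\<close> for \<open>\<rho>\<close> of order \<open>1 / t\<close> by Harnack's inequality.
  The space of these polynomials has dimension \<open>m\<close> of order \<open>t ^ (n - 2)\<close>.  By an argument of Kane, \<open>N\<close>
  points with vanishing sums exist as soon as \<open>N\<close> is at least about \<open>(m + 1) * (K + 1)\<close>.  For every
  polynomial \<open>v\<close> one distributes \<open>N\<close> points continuously along a fixed curve such that all but
  \<open>m + 1\<close> of them nearly maximise \<open>v\<close>.  Then \<open>v\<close> has a positive sum over its points, and the map
  sending \<open>v\<close> to the functional of summation over its points vanishes somewhere, as spheres are not contractible.
\<close>

subsection \<open>Partial derivatives of polynomial functions\<close>

text \<open>The exponent \<open>n - 2\<close> rests on two facts: a harmonic polynomial is fixed by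
  its terms of order 0 and 1 in one coordinate, and the Harnack constant does not grow with
  \<open>t\<close>, because on the scale \<open>1 / t\<close> a form of degree \<open>t\<close>
  changes only by a bounded factor. The obstacle in the topological part is continuity. A maximum
  point of \<open>v\<close> jumps as \<open>v\<close> varies, so the weights come from a concave
  maximisation instead. This costs an additive error \<open>B\<close> independent of
  \<open>v\<close>, which becomes negligible on a sphere of large radius \<open>R\<close>, since the
  maximum of \<open>v\<close> grows linearly with \<open>R\<close>. Passing from weights to
  \<open>N\<close> equally weighted points must be continuous too: each atom causes at most one
  point to be in transit, and there are at most \<open>m + 1\<close> atoms; these are the
  exceptional points. A design is a set, so its points must be distinct although many quantiles sit
  at the same atom. Hence the curve is injective, and a small drift along it separates the
  points.\<close>

lemma homogeneous_polynomial_imp_polynomial: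
  fixes f :: "real ^ 'n \<Rightarrow> real"
  assumes "homogeneous_polynomial t f"
  shows "real_polynomial_function f"
proof -
  obtain c :: "('n \<Rightarrow> nat) \<Rightarrow> real" where
    c: "\<And>x. f x = (\<Sum>\<alpha> | (\<Sum>i\<in>UNIV. \<alpha> i) = t. c \<alpha> * (\<Prod>i\<in>UNIV. (x $ i) ^ \<alpha> i))"
    using assms unfolding homogeneous_polynomial_def by blast
  have "real_polynomial_function (\<lambda>x::real^'n. (x $ i) ^ k)" for i k
    by (intro real_polynomial_function_power real_polynomial_function.intros(1) bounded_linear_vec_nth)
  then show ?thesis
    unfolding c[abs_def]
    by (intro real_polynomial_function_sum real_polynomial_function.intros(4) real_polynomial_function_prod
        real_polynomial_function.intros(2) finite_exponents) auto
qed

text \<open>\<open>deriv\<close> carries information only where a derivative exists, so existence is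
  established first. The witness is again polynomial, which allows \<open>partial_deriv\<close> to
  be iterated in the Laplacian.\<close>

lemma polynomial_directional_derivative:
  fixes f :: "real ^ 'n \<Rightarrow> real"
  assumes "real_polynomial_function f"
  shows "\<exists>g. real_polynomial_function g \<and> (\<forall>x s. ((\<lambda>s. f (x + s *\<^sub>R v)) has_field_derivative g (x + s *\<^sub>R v)) (at s))"
  using assms
proof induction
  case (linear h)
  have "h (x + s *\<^sub>R v) = h x + s * h v" for x s
    by (simp add: linear_simps linear)
  then show ?case
    by (intro exI[of _ "\<lambda>x. h v"]) (auto intro!: derivative_eq_intros real_polynomial_function.intros(2))
next
  case (const c)
  show ?case
    by (intro exI[of _ "\<lambda>x. 0"]) (auto intro!: derivative_eq_intros real_polynomial_function.intros(2))
next
  case (add f g)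
  then obtain f' g' where "real_polynomial_function f'" "real_polynomial_function g'"
    "\<And>x s. ((\<lambda>s. f (x + s *\<^sub>R v)) has_field_derivative f' (x + s *\<^sub>R v)) (at s)"
    "\<And>x s. ((\<lambda>s. g (x + s *\<^sub>R v)) has_field_derivative g' (x + s *\<^sub>R v)) (at s)"
    by blast
  then show ?case
    by (intro exI[of _ "\<lambda>x. f' x + g' x"]) (auto intro!: DERIV_add real_polynomial_function.intros(3))
next
  case (mult f g)
  then obtain f' g' where "real_polynomial_function f'" "real_polynomial_function g'"
    "\<And>x s. ((\<lambda>s. f (x + s *\<^sub>R v)) has_field_derivative f' (x + s *\<^sub>R v)) (at s)"
    "\<And>x s. ((\<lambda>s. g (x + s *\<^sub>R v)) has_field_derivative g' (x + s *\<^sub>R v)) (at s)"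
    by blast
  with mult.hyps show ?case
    by (intro exI[of _ "\<lambda>x. f' x * g x + g' x * f x"])
      (auto intro!: DERIV_mult real_polynomial_function.intros(3) real_polynomial_function.intros(4))
qed

lemma
  fixes f :: "real ^ 'n \<Rightarrow> real"
  assumes "real_polynomial_function f"
  shows polynomial_partial_deriv: "real_polynomial_function (partial_deriv i f)"
    and DERIV_partial_deriv:
      "((\<lambda>s. f (x + s *\<^sub>R axis i 1)) has_field_derivative partial_deriv i f (x + s *\<^sub>R axis i 1)) (at s)"
proof -
  obtain g where g: "real_polynomial_function g"
    "\<And>x s. ((\<lambda>s. f (x + s *\<^sub>R axis i 1)) has_field_derivative g (x + s *\<^sub>R axis i 1)) (at s)"
    using polynomial_directional_derivative[OF assms] by metis
  have "partial_deriv i f = g"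
    using DERIV_imp_deriv[OF g(2)[of _ 0]] by (simp add: partial_deriv_def fun_eq_iff)
  with g show "real_polynomial_function (partial_deriv i f)"
    "((\<lambda>s. f (x + s *\<^sub>R axis i 1)) has_field_derivative partial_deriv i f (x + s *\<^sub>R axis i 1)) (at s)"
    by auto
qed

lemma partial_deriv_eqI:
  assumes "((\<lambda>s. f (x + s *\<^sub>R axis i 1)) has_field_derivative d) (at 0)"
  shows "partial_deriv i f x = d"
  using assms by (simp add: partial_deriv_def DERIV_imp_deriv)

lemma
  fixes f g :: "real ^ 'n \<Rightarrow> real"
  assumes "real_polynomial_function f" "real_polynomial_function g"
  shows partial_deriv_add: "partial_deriv i (\<lambda>x. f x + g x) = (\<lambda>x. partial_deriv i f x + partial_deriv i g x)"
    and partial_deriv_mult: "partial_deriv i (\<lambda>x. f x * g x) = (\<lambda>x. partial_deriv i f x * g x + f x * partial_deriv i g x)"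
proof -
  note D = DERIV_partial_deriv[OF assms(1), where i = i and s = 0] DERIV_partial_deriv[OF assms(2), where i = i and s = 0]
  show "partial_deriv i (\<lambda>x. f x + g x) = (\<lambda>x. partial_deriv i f x + partial_deriv i g x)"
    by (rule ext, rule partial_deriv_eqI) (use D in \<open>auto intro!: derivative_eq_intros\<close>)
  show "partial_deriv i (\<lambda>x. f x * g x) = (\<lambda>x. partial_deriv i f x * g x + f x * partial_deriv i g x)"
    by (rule ext, rule partial_deriv_eqI) (use D in \<open>auto intro!: derivative_eq_intros\<close>)
qed

lemma partial_deriv_const [simp]: "partial_deriv i (\<lambda>x. c) = (\<lambda>x. 0)"
  by (simp add: partial_deriv_def fun_eq_iff)

lemma partial_deriv_bounded_linear:
  fixes h :: "real ^ 'n \<Rightarrow> real"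
  assumes "bounded_linear h"
  shows "partial_deriv i h = (\<lambda>x. h (axis i 1))"
proof -
  interpret bounded_linear h by fact
  show ?thesis
    by (rule ext, rule partial_deriv_eqI) (auto simp: add scaleR intro!: derivative_eq_intros)
qed

text \<open>Chain rule along a ray, by induction on the polynomial; the linear case is the basis
  expansion of \<open>y\<close>. It serves to differentiate weighted means in their radius.\<close>

lemma DERIV_polynomial_ray:
  fixes f :: "real ^ 'n \<Rightarrow> real"
  assumes "real_polynomial_function f"
  shows "((\<lambda>r. f (x + r *\<^sub>R y)) has_field_derivative (\<Sum>i\<in>UNIV. y $ i * partial_deriv i f (x + r *\<^sub>R y))) (at r)"
  using assms
proof induction
  case (linear h)
  interpret bounded_linear h by (rule linear.hyps)
  have "h y = (\<Sum>i\<in>UNIV. y $ i * h (axis i 1))"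
    by (subst basis_expansion[symmetric]) (simp add: sum scaleR scalar_mult_eq_scaleR)
  moreover have "h (x + r *\<^sub>R y) = h x + r * h y" for r
    by (simp add: add scaleR)
  ultimately show ?case
    by (auto simp: partial_deriv_bounded_linear[OF linear.hyps] intro!: derivative_eq_intros)
next
  case (const c)
  show ?case by simp
next
  case (add f g)
  then show ?case
    by (auto simp: partial_deriv_add[OF add.hyps] distrib_left sum.distrib intro!: DERIV_add)
next
  case (mult f g)
  show ?case
    by (rule DERIV_cong[OF DERIV_mult[OF mult.IH]])
      (simp add: partial_deriv_mult[OF mult.hyps] distrib_left sum.distrib sum_distrib_left sum_distrib_right algebra_simps)
qed

text \<open>At the kink the difference quotient is at most \<open>\<bar>h\<bar> ^ k\<close>, which
  tends to 0 because \<open>k \<ge> 1\<close>. Powers of the cut-off weight are thus differentiable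
  across the unit sphere, and integration by parts meets no boundary terms.\<close>

lemma DERIV_max_power:
  fixes u :: real
  assumes "k \<ge> 1"
  shows "((\<lambda>u::real. (max 0 u) ^ Suc k) has_field_derivative real (Suc k) * (max 0 u) ^ k) (at u)"
proof -
  consider "u > 0" | "u < 0" | "u = 0" by linarith
  then show ?thesis
  proof cases
    case 1
    have "((\<lambda>u::real. u ^ Suc k) has_field_derivative Suc k * u ^ k) (at u)"
      by (rule derivative_eq_intros refl)+ (simp add: algebra_simps)
    then show ?thesis
      by (rule has_field_derivative_transform_within_open[where S = "{0<..}", THEN DERIV_cong]) (use 1 in auto)
  next
    case 2
    have "((\<lambda>u::real. 0) has_field_derivative 0) (at u)" by simp
    then show ?thesis
      by (rule has_field_derivative_transform_within_open[where S = "{..<0}", THEN DERIV_cong])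
        (use 2 assms in \<open>auto simp: power_0_left\<close>)
  next
    case 3
    have "((\<lambda>h::real. (max 0 h) ^ Suc k / h) \<longlongrightarrow> 0) (at 0)"
    proof (rule Lim_null_comparison)
      show "\<forall>\<^sub>F h::real in at 0. norm ((max 0 h) ^ Suc k / h) \<le> \<bar>h\<bar> ^ k"
        by (intro always_eventually allI) (auto simp: max_def)
      show "((\<lambda>h::real. \<bar>h\<bar> ^ k) \<longlongrightarrow> 0) (at 0)"
        using assms by (auto intro!: tendsto_eq_intros simp: power_0_left)
    qed
    then show ?thesis
      using assms 3 by (simp add: DERIV_def power_0_left)
  qed
qed

subsection \<open>The mean value property\<close>

text \<open>Translation invariance: the integral of \<open>G (y + s *\<^sub>R v)\<close> over the
  larger box does not depend on small \<open>s\<close>, as the shifted support stays inside.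
  Differentiating under the integral at \<open>s = 0\<close> gives the claim.\<close>

lemma integral_partial_derivative_eq_0:
  fixes G :: "real ^ 'n \<Rightarrow> real"
  assumes D: "\<And>y s. ((\<lambda>s. G (y + s *\<^sub>R v)) has_field_derivative D (y + s *\<^sub>R v)) (at s)"
    and contG: "continuous_on UNIV G" and contD: "continuous_on UNIV D"
    and supp: "\<And>y. y \<notin> cbox a b \<Longrightarrow> G y = 0"
    and fits: "\<And>y s. \<bar>s\<bar> < 1 \<Longrightarrow> y \<in> cbox a b \<Longrightarrow> y - s *\<^sub>R v \<in> cbox c d"
  shows "integral (cbox c d) D = 0"
proof -
  define h where "h = (\<lambda>s. integral (cbox c d) (\<lambda>y. G (y + s *\<^sub>R v)))"
  have "(h has_field_derivative integral (cbox c d) (\<lambda>y. D (y + 0 *\<^sub>R v))) (at 0 within UNIV)"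
    unfolding h_def
    by (rule leibniz_rule_field_derivative[where fx = "\<lambda>s y. D (y + s *\<^sub>R v)"])
       (auto simp: case_prod_unfold intro!: D integrable_continuous continuous_on_compose2[OF contG] continuous_on_compose2[OF contD] continuous_intros)
  moreover have "h s = integral UNIV G" if "\<bar>s\<bar> < 1" for s
  proof -
    obtain I where I: "(G has_integral I) (cbox a b)"
      using integrable_continuous[OF continuous_on_subset[OF contG subset_UNIV]] unfolding integrable_on_def by blast
    have "(G has_integral I) UNIV"
      by (rule has_integral_on_superset[OF I]) (use supp in auto)
    moreover have "((\<lambda>y. G (y + s *\<^sub>R v)) has_integral I) (cbox (a - s *\<^sub>R v) (b - s *\<^sub>R v))"
      by (rule has_integral_shift_cbox[OF I])
    then have "((\<lambda>y. G (y + s *\<^sub>R v)) has_integral I) (cbox c d)"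
    proof (rule has_integral_on_superset)
      have *: "y \<in> cbox (a - s *\<^sub>R v) (b - s *\<^sub>R v) \<longleftrightarrow> y + s *\<^sub>R v \<in> cbox a b" for y
        by (auto simp: mem_box inner_diff_left inner_add_left algebra_simps)
      show "G (y + s *\<^sub>R v) = 0" if "y \<notin> cbox (a - s *\<^sub>R v) (b - s *\<^sub>R v)" for y
        using that supp by (simp add: *)
      show "cbox (a - s *\<^sub>R v) (b - s *\<^sub>R v) \<subseteq> cbox c d"
        using fits[OF that] by (force simp: *)
    qed
    ultimately show ?thesis
      by (simp add: h_def integral_unique)
  qed
  then have "(h has_field_derivative 0) (at 0)"
    by (intro has_field_derivative_transform_within_open[OF DERIV_const, of "{-1<..<1}" _ "integral UNIV G"]) auto
  ultimately have "integral (cbox c d) (\<lambda>y. D (y + 0 *\<^sub>R v)) = 0"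
    by (rule DERIV_unique)
  then show ?thesis by simp
qed

lemma continuous_on_polynomial:
  fixes f :: "real ^ 'n \<Rightarrow> real"
  assumes "real_polynomial_function f" "continuous_on A g"
  shows "continuous_on A (\<lambda>x. f (g x))"
  using assms(1)
proof induction
  case (linear h)
  then show ?case using assms(2) by (rule bounded_linear.continuous_on)
qed (auto intro: continuous_intros)

text \<open>A radial weight supported in the closed unit ball. It replaces the spherical averages of
  the classical mean value property, so that all integrals run over a fixed box.\<close>

definition bump :: "nat \<Rightarrow> real ^ 'n \<Rightarrow> real" where
  "bump k y = (max 0 (1 - y \<bullet> y)) ^ k"

lemma continuous_on_bump [continuous_intros]: "continuous_on A g \<Longrightarrow> continuous_on A (\<lambda>x. bump k (g x))"
  unfolding bump_def by (intro continuous_intros)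

lemma DERIV_bump:
  assumes "k \<ge> 1"
  shows "((\<lambda>s. bump (Suc k) (y + s *\<^sub>R axis i 1)) has_field_derivative
     - (2 * real (Suc k)) * (y + s *\<^sub>R axis i 1) $ i * bump k (y + s *\<^sub>R axis i 1)) (at s)"
proof -
  have eq: "(y + s *\<^sub>R axis i 1) \<bullet> (y + s *\<^sub>R axis i 1) = y \<bullet> y + 2 * s * y $ i + s\<^sup>2" for s
    by (simp add: inner_add_left inner_add_right inner_axis inner_axis' power2_eq_square algebra_simps)
  have "((\<lambda>s. 1 - (y \<bullet> y + 2 * s * y $ i + s\<^sup>2)) has_field_derivative - 2 * (y $ i + s)) (at s)"
    by (auto intro!: derivative_eq_intros)
  from DERIV_chain2[OF DERIV_max_power[OF assms] this]
  show ?thesis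
    unfolding bump_def eq by (rule DERIV_cong) (simp add: algebra_simps)
qed

lemma bump_eq_0: "norm y \<ge> 1 \<Longrightarrow> k > 0 \<Longrightarrow> bump k y = 0"
  using power_mono[of 1 "norm y" 2] by (simp add: bump_def dot_square_norm)

lemma bump_nonneg: "bump k y \<ge> 0"
  by (simp add: bump_def)

text \<open>Half-side 2 leaves room to translate the box of half-side 1 around the support of the
  weight by less than one unit along an axis.\<close>

abbreviation cube2 :: "(real ^ 'n) set" where "cube2 \<equiv> cbox (\<chi> i. -2) (\<chi> i. 2)"

lemma mem_cube: "(y :: real ^ 'n) \<in> cbox (\<chi> i. - r) (\<chi> i. r) \<longleftrightarrow> (\<forall>i. \<bar>y $ i\<bar> \<le> r)"
  by (auto simp: mem_box_cart abs_le_iff minus_le_iff)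

lemma ball_subset_cube2: "norm (y :: real ^ 'n) < 2 \<Longrightarrow> y \<in> cube2"
proof -
  assume "norm y < 2"
  then have "\<bar>y $ i\<bar> \<le> 2" for i
    using component_le_norm_cart[of y i] by linarith
  then show ?thesis by (simp add: mem_cube)
qed

text \<open>The weight \<open>y * bump 2 y\<close> is a multiple of the gradient of \<open>bump 3\<close>, so the derivative of the
  weighted mean in the radius \<open>\<rho>\<close> is, after integration by parts, a weighted mean of the Laplacian.\<close>
lemma bump_mean_value:
  fixes f :: "real ^ 'n \<Rightarrow> real"
  assumes f: "real_polynomial_function f" and harm: "\<And>x. laplacian f x = 0"
  shows "integral cube2 (\<lambda>y. bump 2 y * f (x + \<rho> *\<^sub>R y)) = f x * integral cube2 (bump 2 :: real ^ 'n \<Rightarrow> real)"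
proof -
  define I where "I = (\<lambda>\<rho>. integral cube2 (\<lambda>y. bump 2 y * f (x + \<rho> *\<^sub>R y)))"
  note pf = polynomial_partial_deriv[OF f] polynomial_partial_deriv[OF polynomial_partial_deriv[OF f]]
  note [continuous_intros] = f[THEN continuous_on_polynomial] pf[THEN continuous_on_polynomial]
  have "(I has_field_derivative 0) (at \<rho>)" for \<rho>
  proof -
    have "integral cube2 (\<lambda>y. \<Sum>i\<in>UNIV. bump 2 y * (y $ i * partial_deriv i f (x + \<rho> *\<^sub>R y))) = 0"
    proof -
      have i: "integral cube2 (\<lambda>y. bump 2 y * (y $ i * partial_deriv i f (x + \<rho> *\<^sub>R y))) =
         \<rho> / 6 * integral cube2 (\<lambda>y. bump 3 y * partial_deriv i (partial_deriv i f) (x + \<rho> *\<^sub>R y))" for i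
      proof -
        \<comment> \<open>\<open>D\<close> is the derivative in direction \<open>i\<close> of
          \<open>bump 3 y * partial_deriv i f (x + \<rho> *\<^sub>R y)\<close>: the factor
          \<open>6 = 2 * 3\<close> comes from \<open>DERIV_bump\<close>, the factor
          \<open>\<rho>\<close> from the chain rule.\<close>
        define D where "D = (\<lambda>y. bump 3 y * (\<rho> * partial_deriv i (partial_deriv i f) (x + \<rho> *\<^sub>R y))
            - 6 * (bump 2 y * (y $ i * partial_deriv i f (x + \<rho> *\<^sub>R y))))"
        have "integral cube2 D = 0"
        proof (rule integral_partial_derivative_eq_0[where G = "\<lambda>y. bump 3 y * partial_deriv i f (x + \<rho> *\<^sub>R y)"
              and v = "axis i 1" and a = "\<chi> i. -1" and b = "\<chi> i. 1"])
          fix y :: "real ^ 'n" and s :: real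
          have v: "x + \<rho> *\<^sub>R (y + s *\<^sub>R axis i 1) = (x + \<rho> *\<^sub>R y) + (\<rho> * s) *\<^sub>R axis i 1" for s
            by (simp add: scaleR_add_right)
          have "((\<lambda>s. partial_deriv i f ((x + \<rho> *\<^sub>R y) + (\<rho> * s) *\<^sub>R axis i 1)) has_field_derivative
             partial_deriv i (partial_deriv i f) ((x + \<rho> *\<^sub>R y) + (\<rho> * s) *\<^sub>R axis i 1) * \<rho>) (at s)"
            by (rule DERIV_chain2[OF DERIV_partial_deriv[OF pf(1)]]) (auto intro!: derivative_eq_intros)
          have expand: "(- (6 * a) - 6 * b) * c * d = - (6 * (c * ((a + b) * d)))" for a b c d :: real
            by (simp add: algebra_simps)
          from DERIV_mult[OF DERIV_bump[where k = 2] \<open>((\<lambda>s. partial_deriv i f _) has_field_derivative _) (at s)\<close>]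
          have "((\<lambda>s. bump (Suc 2) (y + s *\<^sub>R axis i 1) * partial_deriv i f ((x + \<rho> *\<^sub>R y) + (\<rho> * s) *\<^sub>R axis i 1))
              has_field_derivative D (y + s *\<^sub>R axis i 1)) (at s)"
            by (rule DERIV_cong) (simp, simp add: D_def v, rule expand)
          then show "((\<lambda>s. bump 3 (y + s *\<^sub>R axis i 1) * partial_deriv i f (x + \<rho> *\<^sub>R (y + s *\<^sub>R axis i 1)))
              has_field_derivative D (y + s *\<^sub>R axis i 1)) (at s)"
            by (simp only: v) simp
        next
          show "continuous_on UNIV (\<lambda>y. bump 3 y * partial_deriv i f (x + \<rho> *\<^sub>R y))"
            by (intro continuous_intros)
          show "continuous_on UNIV D"
            unfolding D_def by (intro continuous_intros)
        next
          fix y :: "real ^ 'n" assume "y \<notin> cbox (\<chi> i. -1) (\<chi> i. 1)"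
          then obtain j where "\<bar>y $ j\<bar> \<ge> 1" unfolding mem_cube by (auto simp: not_le intro: less_imp_le)
          then have "norm y \<ge> 1" using component_le_norm_cart[of y j] by linarith
          then show "bump 3 y * partial_deriv i f (x + \<rho> *\<^sub>R y) = 0" by (simp add: bump_eq_0)
        next
          fix y :: "real ^ 'n" and s :: real
          assume "\<bar>s\<bar> < 1" and y: "y \<in> cbox (\<chi> i. -1) (\<chi> i. 1)"
          have "\<bar>y $ j - s * axis i 1 $ j\<bar> \<le> 2" for j
          proof -
            have "\<bar>s * axis i 1 $ j\<bar> \<le> 1" using \<open>\<bar>s\<bar> < 1\<close> by (auto simp: axis_def)
            moreover have "\<bar>y $ j\<bar> \<le> 1" using y by (simp add: mem_cube)
            ultimately show ?thesis by linarith
          qed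
          then show "y - s *\<^sub>R axis i 1 \<in> cube2"
            by (simp add: mem_cube)
        qed
        moreover have "integral cube2 D =
            integral cube2 (\<lambda>y. bump 3 y * (\<rho> * partial_deriv i (partial_deriv i f) (x + \<rho> *\<^sub>R y)))
            - integral cube2 (\<lambda>y. 6 * (bump 2 y * (y $ i * partial_deriv i f (x + \<rho> *\<^sub>R y))))"
          unfolding D_def by (intro integral_diff integrable_continuous continuous_intros)
        moreover have "integral cube2 (\<lambda>y. bump 3 y * (\<rho> * partial_deriv i (partial_deriv i f) (x + \<rho> *\<^sub>R y)))
           = \<rho> * integral cube2 (\<lambda>y. bump 3 y * partial_deriv i (partial_deriv i f) (x + \<rho> *\<^sub>R y))"
          by (subst integral_mult_right[symmetric]) (simp add: mult_ac)
        ultimately show ?thesis by simp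
      qed
      have "integral cube2 (\<lambda>y. \<Sum>i\<in>UNIV. bump 2 y * (y $ i * partial_deriv i f (x + \<rho> *\<^sub>R y))) =
          (\<Sum>i\<in>UNIV. integral cube2 (\<lambda>y. bump 2 y * (y $ i * partial_deriv i f (x + \<rho> *\<^sub>R y))))"
        by (intro integral_sum integrable_continuous continuous_intros) auto
      also have "\<dots> = \<rho> / 6 * (\<Sum>i\<in>UNIV. integral cube2 (\<lambda>y. bump 3 y * partial_deriv i (partial_deriv i f) (x + \<rho> *\<^sub>R y)))"
        unfolding i by (simp add: sum_distrib_left)
      also have "(\<Sum>i\<in>UNIV. integral cube2 (\<lambda>y. bump 3 y * partial_deriv i (partial_deriv i f) (x + \<rho> *\<^sub>R y)))
          = integral cube2 (\<lambda>y. \<Sum>i\<in>UNIV. bump 3 y * partial_deriv i (partial_deriv i f) (x + \<rho> *\<^sub>R y))"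
        by (intro integral_sum[symmetric] integrable_continuous continuous_intros) auto
      also have "\<dots> = integral cube2 (\<lambda>y. bump 3 y * laplacian f (x + \<rho> *\<^sub>R y))"
        by (simp add: laplacian_def sum_distrib_left)
      finally show ?thesis by (simp add: harm)
    qed
    moreover have "(I has_field_derivative
       integral cube2 (\<lambda>y. bump 2 y * (\<Sum>i\<in>UNIV. y $ i * partial_deriv i f (x + \<rho> *\<^sub>R y)))) (at \<rho> within UNIV)"
      unfolding I_def
    proof (rule leibniz_rule_field_derivative[where fx = "\<lambda>\<rho> y. bump 2 y * (\<Sum>i\<in>UNIV. y $ i * partial_deriv i f (x + \<rho> *\<^sub>R y))"])
      show "((\<lambda>\<rho>. bump 2 y * f (x + \<rho> *\<^sub>R y)) has_field_derivative
          bump 2 y * (\<Sum>i\<in>UNIV. y $ i * partial_deriv i f (x + \<rho> *\<^sub>R y))) (at \<rho> within UNIV)" for \<rho> y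
        by (intro DERIV_cmult DERIV_polynomial_ray f)
      show "(\<lambda>y. bump 2 y * f (x + \<rho> *\<^sub>R y)) integrable_on cube2" for \<rho>
        by (intro integrable_continuous continuous_intros)
      show "continuous_on (UNIV \<times> cube2) (\<lambda>(\<rho>, y). bump 2 y * (\<Sum>i\<in>UNIV. y $ i * partial_deriv i f (x + \<rho> *\<^sub>R y)))"
        unfolding case_prod_unfold by (intro continuous_intros)
    qed auto
    ultimately show ?thesis by (simp add: sum_distrib_left)
  qed
  then have "I \<rho> = I 0"
    using DERIV_isconst_all by blast
  then show ?thesis by (simp add: I_def mult.commute)
qed

subsection \<open>Harnack's inequality for harmonic polynomials\<close>

lemma integral_bump_pos: "integral cube2 (bump k :: real ^ 'n \<Rightarrow> real) > 0"
proof -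
  have "integral cube2 (bump k :: real ^ 'n \<Rightarrow> real) \<ge> 0"
    by (intro integral_nonneg integrable_continuous continuous_intros bump_nonneg)
  moreover have "integral cube2 (bump k :: real ^ 'n \<Rightarrow> real) \<noteq> 0"
  proof
    assume 0: "integral cube2 (bump k :: real ^ 'n \<Rightarrow> real) = 0"
    have "bump k (0 :: real ^ 'n) = 0"
    proof (rule has_integral_0_cbox_imp_0[where f = "bump k" and a = "\<chi> i. -2" and b = "\<chi> i. 2"])
      show cont: "continuous_on cube2 (bump k :: real ^ 'n \<Rightarrow> real)"
        using continuous_on_bump[OF continuous_on_id] by simp
      show "(bump k has_integral 0) (cube2 :: (real ^ 'n) set)"
        using integrable_integral[OF integrable_continuous[OF cont]] 0 by simp
      have "(0 :: real ^ 'n) \<in> box (\<chi> i. -2) (\<chi> i. 2)"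
        by (simp add: mem_box_cart)
      then show "box (\<chi> i. -2) (\<chi> i. 2) \<noteq> ({} :: (real ^ 'n) set)" by blast
    qed (auto simp: bump_nonneg mem_cube)
    then show False by (simp add: bump_def)
  qed
  ultimately show ?thesis by simp
qed

text \<open>Compares the weight of a ball of radius \<open>\<rho>\<close> about
  \<open>p + \<rho> *\<^sub>R e\<close> with that of the ball of radius \<open>4 * \<rho>\<close>
  about \<open>p\<close>, in the coordinates of the latter. Where the left side is nonzero,
  \<open>norm y \<le> 1/2\<close>, so \<open>bump 2 y \<ge> 9/16\<close>, while the left side is at
  most 1.\<close>

lemma bump_rescale_le:
  fixes e y :: "real ^ 'n"
  assumes "norm e \<le> 1"
  shows "bump 2 (4 *\<^sub>R y - e) \<le> 2 * bump 2 y"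
proof (cases "norm (4 *\<^sub>R y - e) < 1")
  case True
  have "4 * norm y \<le> norm (4 *\<^sub>R y - e) + norm e"
    using norm_triangle_ineq[of "4 *\<^sub>R y - e" e] by simp
  then have "norm y \<le> 1/2" using True assms by simp
  then have "(norm y)\<^sup>2 \<le> (1/2)\<^sup>2" by (intro power_mono) auto
  then have "3/4 \<le> 1 - y \<bullet> y" by (simp add: dot_square_norm power2_eq_square)
  then have "3/4 \<le> max 0 (1 - y \<bullet> y)" by linarith
  then have "(3/4)\<^sup>2 \<le> bump 2 y" unfolding bump_def by (rule power_mono) simp
  moreover have "bump 2 (4 *\<^sub>R y - e) \<le> 1\<^sup>2" unfolding bump_def by (intro power_mono) auto
  ultimately show ?thesis by (simp add: power2_eq_square)
next
  case False
  then show ?thesis using bump_nonneg[of 2 y] by (simp add: bump_eq_0)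
qed

text \<open>\<open>B - f\<close> is nonnegative on the large ball about \<open>p\<close>, so its
  weighted mean over the small ball about \<open>p'\<close> is controlled by that over the large
  ball. The factor 2 is that of \<open>bump_rescale_le\<close>; \<open>4 ^ CARD('n)\<close> is the
  Jacobian of the rescaling.\<close>

lemma harnack_harmonic_polynomial:
  fixes f :: "real ^ 'n \<Rightarrow> real"
  assumes f: "real_polynomial_function f" and harm: "\<And>x. laplacian f x = 0"
    and le: "\<And>x. dist p x < 4 * \<rho> \<Longrightarrow> f x \<le> B" and \<rho>: "\<rho> > 0" and near: "dist p p' \<le> \<rho>"
  shows "B - f p' \<le> 2 * 4 ^ CARD('n) * (B - f p)"
proof -
  define c0 where "c0 = integral cube2 (bump 2 :: real ^ 'n \<Rightarrow> real)"
  have c0: "c0 > 0" by (simp add: c0_def integral_bump_pos)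
  note [continuous_intros] = f[THEN continuous_on_polynomial]
  have int: "((\<lambda>y. bump 2 y * (B - f (x + r *\<^sub>R y))) has_integral c0 * (B - f x)) cube2" for x r
  proof -
    have "((\<lambda>y. B * bump 2 y - bump 2 y * f (x + r *\<^sub>R y)) has_integral B * c0 - f x * c0) cube2"
      unfolding c0_def bump_mean_value[OF f harm, symmetric, of x r]
      by (intro has_integral_diff has_integral_mult_right integrable_integral integrable_continuous continuous_intros)
    then show ?thesis by (simp add: algebra_simps)
  qed
  define e where "e = (p' - p) /\<^sub>R \<rho>"
  have e: "norm e \<le> 1" using near \<rho> by (simp add: e_def dist_norm norm_minus_commute divide_inverse_commute[symmetric])
  have pe: "p' + \<rho> *\<^sub>R (4 *\<^sub>R y - e) = p + (4 * \<rho>) *\<^sub>R y" for y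
    using \<rho> by (simp add: e_def scaleR_diff_right algebra_simps)
  have "((\<lambda>y. bump 2 (4 *\<^sub>R y + - e) * (B - f (p' + \<rho> *\<^sub>R (4 *\<^sub>R y + - e)))) has_integral (c0 * (B - f p')) /\<^sub>R 4 ^ DIM(real ^ 'n))
      (cbox (((\<chi> i. -2) - - e) /\<^sub>R 4) (((\<chi> i. 2) - - e) /\<^sub>R 4))"
    by (rule has_integral_affinity'[OF int]) simp
  then have "((\<lambda>y. bump 2 (4 *\<^sub>R y - e) * (B - f (p + (4 * \<rho>) *\<^sub>R y))) has_integral (c0 * (B - f p')) /\<^sub>R 4 ^ DIM(real ^ 'n))
      (cbox (((\<chi> i. -2) + e) /\<^sub>R 4) (((\<chi> i. 2) + e) /\<^sub>R 4))"
    unfolding add_uminus_conv_diff diff_minus_eq_add pe .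
  then have "((\<lambda>y. bump 2 (4 *\<^sub>R y - e) * (B - f (p + (4 * \<rho>) *\<^sub>R y))) has_integral (c0 * (B - f p')) /\<^sub>R 4 ^ DIM(real ^ 'n)) UNIV"
  proof (rule has_integral_on_superset)
    fix y :: "real ^ 'n" assume y: "y \<notin> cbox (((\<chi> i. -2) + e) /\<^sub>R 4) (((\<chi> i. 2) + e) /\<^sub>R 4)"
    have "4 *\<^sub>R y - e \<notin> cube2"
    proof
      assume "4 *\<^sub>R y - e \<in> cube2"
      then have "-2 \<le> 4 * y $ i - e $ i" "4 * y $ i - e $ i \<le> 2" for i by (simp_all add: mem_box_cart)
      then have "-2 + e $ i \<le> 4 * y $ i" "4 * y $ i \<le> 2 + e $ i" for i by (simp_all add: algebra_simps)
      with y show False by (simp add: mem_box_cart divide_le_eq le_divide_eq mult.commute flip: divide_inverse_commute)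
    qed
    then have "norm (4 *\<^sub>R y - e) \<ge> 1"
      using ball_subset_cube2[of "4 *\<^sub>R y - e"] by linarith
    then show "bump 2 (4 *\<^sub>R y - e) * (B - f (p + (4 * \<rho>) *\<^sub>R y)) = 0" by (simp add: bump_eq_0)
  qed auto
  moreover have "((\<lambda>y. 2 * (bump 2 y * (B - f (p + (4 * \<rho>) *\<^sub>R y)))) has_integral 2 * (c0 * (B - f p))) UNIV"
  proof (rule has_integral_on_superset[OF has_integral_mult_right[OF int]])
    fix y :: "real ^ 'n" assume "y \<notin> cube2"
    then have "norm y \<ge> 1"
      using ball_subset_cube2[of y] by linarith
    then show "2 * (bump 2 y * (B - f (p + (4 * \<rho>) *\<^sub>R y))) = 0" by (simp add: bump_eq_0)
  qed auto
  ultimately have "(c0 * (B - f p')) /\<^sub>R 4 ^ DIM(real ^ 'n) \<le> 2 * (c0 * (B - f p))"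
  proof (rule has_integral_le)
    fix y :: "real ^ 'n"
    show "bump 2 (4 *\<^sub>R y - e) * (B - f (p + (4 * \<rho>) *\<^sub>R y)) \<le> 2 * (bump 2 y * (B - f (p + (4 * \<rho>) *\<^sub>R y)))"
    proof (cases "norm y < 1")
      case True
      then have "B - f (p + (4 * \<rho>) *\<^sub>R y) \<ge> 0" using \<rho> le[of "p + (4 * \<rho>) *\<^sub>R y"] by (simp add: dist_norm)
      from mult_right_mono[OF bump_rescale_le[OF e] this] show ?thesis by (simp add: mult.assoc)
    next
      case False
      then have "bump 2 y = 0" by (simp add: bump_eq_0)
      moreover have "bump 2 (4 *\<^sub>R y - e) = 0"
        using bump_rescale_le[OF e, of y] bump_nonneg[of 2 "4 *\<^sub>R y - e"] calculation by simp
      ultimately show ?thesis by simp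
    qed
  qed
  then have "c0 * (B - f p') \<le> c0 * (2 * 4 ^ CARD('n) * (B - f p))"
    by (simp add: field_simps)
  then show ?thesis using c0 by (simp add: mult_le_cancel_left_pos)
qed

lemma homogeneous_polynomial_scale:
  fixes f :: "real ^ 'n \<Rightarrow> real"
  assumes "homogeneous_polynomial t f"
  shows "f (r *\<^sub>R x) = r ^ t * f x"
proof -
  obtain c :: "('n \<Rightarrow> nat) \<Rightarrow> real" where
    c: "\<And>x. f x = (\<Sum>\<alpha> | (\<Sum>i\<in>UNIV. \<alpha> i) = t. c \<alpha> * (\<Prod>i\<in>UNIV. (x $ i) ^ \<alpha> i))"
    using assms unfolding homogeneous_polynomial_def by blast
  show ?thesis
    unfolding c sum_distrib_left
    by (rule sum.cong) (auto simp: power_mult_distrib prod.distrib power_sum[symmetric])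
qed

text \<open>This is \<open>Q * exp (4 * Q)\<close> for the Harnack factor
  \<open>Q = 2 * 4 ^ n\<close>.\<close>

definition harnack_const :: "nat \<Rightarrow> real" where
  "harnack_const n = 2 * 4 ^ n * exp (8 * 4 ^ n)"

lemma Harm_lower_bound:
  fixes f :: "real ^ 'n \<Rightarrow> real"
  assumes f: "f \<in> Harm t" and t: "t \<ge> 1" and b: "b \<ge> 0"
    and le: "\<And>x. norm x = 1 \<Longrightarrow> f x \<le> b" and p: "norm p = 1"
  shows "f p \<ge> - (harnack_const CARD('n) * b)"
proof -
  define Q :: real where "Q = 2 * 4 ^ CARD('n)"
  have Q: "Q \<ge> 1" using one_le_power[of "4::real" "CARD('n)"] unfolding Q_def by linarith
  \<comment> \<open>With this radius Bernoulli gives \<open>(1 + \<rho>) ^ t \<ge> 1 + Q\<close>,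
    exceeding the Harnack factor \<open>Q\<close> by 1, so that \<open>main\<close> can be solved
    for \<open>- f p\<close>. At the same time \<open>(1 + 4 * \<rho>) ^ t \<le> exp (4 * Q)\<close>
    stays bounded in \<open>t\<close>.\<close>
  define \<rho> where "\<rho> = Q / t"
  define B where "B = b * (1 + 4 * \<rho>) ^ t"
  have \<rho>: "\<rho> > 0" using Q t by (simp add: \<rho>_def)
  have h: "homogeneous_polynomial t f" and harm: "laplacian f x = 0" for x
    using f by (auto simp: Harm_def)
  have scale: "f x \<le> norm x ^ t * b" for x
  proof (cases "x = 0")
    case True
    then show ?thesis using homogeneous_polynomial_scale[OF h, of 0 x] t by (simp add: power_0_left)
  next
    case False
    have "f x = norm x ^ t * f (x /\<^sub>R norm x)"
      using homogeneous_polynomial_scale[OF h, of "norm x" "x /\<^sub>R norm x"] False by simp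
    then show ?thesis using le[of "x /\<^sub>R norm x"] False by (simp add: mult_left_mono)
  qed
  have "B - f ((1 + \<rho>) *\<^sub>R p) \<le> 2 * 4 ^ CARD('n) * (B - f p)"
  proof (rule harnack_harmonic_polynomial[OF homogeneous_polynomial_imp_polynomial[OF h] harm _ \<rho>])
    fix x assume "dist p x < 4 * \<rho>"
    then have "norm x \<le> 1 + 4 * \<rho>"
      using p norm_triangle_sub[of x p] by (simp add: dist_norm norm_minus_commute)
    then have "norm x ^ t * b \<le> (1 + 4 * \<rho>) ^ t * b"
      using b by (intro mult_right_mono power_mono) auto
    then show "f x \<le> B" using scale[of x] by (simp add: B_def mult.commute)
  next
    show "dist p ((1 + \<rho>) *\<^sub>R p) \<le> \<rho>"
      using \<rho> p by (simp add: dist_norm scaleR_add_left)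
  qed
  then have main: "B - (1 + \<rho>) ^ t * f p \<le> Q * (B - f p)"
    using homogeneous_polynomial_scale[OF h, of "1 + \<rho>" p] by (simp add: Q_def)
  have bern: "(1 + \<rho>) ^ t \<ge> 1 + Q"
    using Bernoulli_inequality[of \<rho> t] \<rho> t by (simp add: \<rho>_def)
  have "(1 + 4 * \<rho>) ^ t \<le> exp (4 * \<rho>) ^ t"
    using \<rho> exp_ge_add_one_self[of "4 * \<rho>"] by (intro power_mono) auto
  also have "\<dots> = exp (4 * Q)"
    using t by (simp add: \<rho>_def flip: exp_of_nat_mult)
  finally have B: "B \<le> b * exp (4 * Q)" "B \<ge> 0"
    using b \<rho> by (auto simp: B_def mult_left_mono)
  show ?thesis
  proof (cases "f p \<ge> 0")
    case True
    then show ?thesis using b by (smt (verit) harnack_const_def exp_gt_zero mult_nonneg_nonneg zero_le_power)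
  next
    case False
    have "- f p * 1 \<le> - f p * ((1 + \<rho>) ^ t - Q)"
      using False bern by (intro mult_left_mono) auto
    also have "\<dots> \<le> (Q - 1) * B"
      using main by (simp add: algebra_simps)
    also have "\<dots> \<le> Q * (b * exp (4 * Q))"
      using B Q by (intro mult_mono) auto
    finally show ?thesis
      by (simp add: harnack_const_def Q_def mult_ac)
  qed
qed

subsection \<open>The dimension of the space of harmonic polynomials\<close>

text \<open>Elimination, by induction on the equations: an unknown \<open>k0\<close> with nonzero
  coefficient in equation \<open>i\<close> is solved for and substituted into the others. It serves
  for the dimension bound and for affine dependences between atoms.\<close>

lemma homogeneous_system_nontrivial_solution:
  fixes A :: "'k \<Rightarrow> 'i \<Rightarrow> real"
  assumes "finite I" "finite K" "card I < card K"
  shows "\<exists>a. (\<exists>k\<in>K. a k \<noteq> 0) \<and> (\<forall>k. k \<notin> K \<longrightarrow> a k = 0) \<and> (\<forall>i\<in>I. (\<Sum>k\<in>K. a k * A k i) = 0)"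
  using assms
proof (induction I arbitrary: K A rule: finite_induct)
  case empty
  then obtain k where "k \<in> K" by fastforce
  then show ?case by (intro exI[of _ "\<lambda>j. if j = k then 1 else 0"]) auto
next
  case (insert i I)
  show ?case
  proof (cases "\<forall>k\<in>K. A k i = 0")
    case True
    obtain a where "\<exists>k\<in>K. a k \<noteq> 0" "\<forall>k. k \<notin> K \<longrightarrow> a k = 0" "\<forall>i\<in>I. (\<Sum>k\<in>K. a k * A k i) = 0"
      using insert.IH[of K A] insert.prems insert.hyps by auto
    with True show ?thesis by (intro exI[of _ a]) auto
  next
    case False
    then obtain k0 where k0: "k0 \<in> K" "A k0 i \<noteq> 0" by blast
    define A' where "A' = (\<lambda>k j. A k j - A k i / A k0 i * A k0 j)"
    have "card I < card (K - {k0})" using insert k0 by simp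
    then obtain a where a: "\<exists>k\<in>K - {k0}. a k \<noteq> 0" "\<And>k. k \<notin> K - {k0} \<Longrightarrow> a k = 0"
      "\<And>j. j \<in> I \<Longrightarrow> (\<Sum>k\<in>K - {k0}. a k * A' k j) = 0"
      using insert.IH[of "K - {k0}" A'] insert.prems by auto
    define b where "b = a(k0 := - (\<Sum>k\<in>K - {k0}. a k * A k i) / A k0 i)"
    have sum_b: "(\<Sum>k\<in>K. b k * A k j) = (\<Sum>k\<in>K - {k0}. a k * A' k j)" for j
    proof -
      have "(\<Sum>k\<in>K. b k * A k j) = b k0 * A k0 j + (\<Sum>k\<in>K - {k0}. b k * A k j)"
        using insert.prems k0 by (simp add: sum.remove)
      also have "(\<Sum>k\<in>K - {k0}. b k * A k j) = (\<Sum>k\<in>K - {k0}. a k * A k j)"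
        by (rule sum.cong) (auto simp: b_def)
      also have "b k0 * A k0 j = - (\<Sum>k\<in>K - {k0}. a k * (A k i / A k0 i * A k0 j))"
        by (simp add: b_def sum_distrib_right sum_divide_distrib mult.assoc)
      finally show ?thesis
        by (simp add: A'_def sum_subtractf algebra_simps)
    qed
    have "(\<Sum>k\<in>K. b k * A k j) = 0" if "j \<in> insert i I" for j
      using that a(3) k0 by (auto simp: sum_b A'_def)
    moreover have "\<exists>k\<in>K. b k \<noteq> 0" using a(1) by (auto simp: b_def)
    moreover have "b k = 0" if "k \<notin> K" for k using that a(2) k0 by (auto simp: b_def)
    ultimately show ?thesis by blast
  qed
qed

text \<open>\<open>\<alpha> e\<close> has two possible values, the exponents outside
  \<open>{e, e'}\<close> have at most \<open>t + 1\<close> each, and the total degree then forces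
  \<open>\<alpha> e'\<close>. These vectors index the Cauchy data of a harmonic polynomial on the
  hyperplane where coordinate \<open>e\<close> vanishes.\<close>

lemma card_exponents_le:
  fixes e e' :: "'n::finite"
  assumes "e \<noteq> e'"
  shows "card {\<alpha> :: 'n \<Rightarrow> nat. (\<Sum>i\<in>UNIV. \<alpha> i) = t \<and> \<alpha> e \<le> 1} \<le> 2 * (t + 1) ^ (CARD('n) - 2)"
proof -
  let ?I = "{\<alpha> :: 'n \<Rightarrow> nat. (\<Sum>i\<in>UNIV. \<alpha> i) = t \<and> \<alpha> e \<le> 1}"
  let ?P = "{..1::nat} \<times> ((UNIV - {e, e'}) \<rightarrow>\<^sub>E {..t})"
  have split: "(\<Sum>i\<in>UNIV. \<alpha> i) = \<alpha> e + \<alpha> e' + (\<Sum>i\<in>UNIV - {e, e'}. \<alpha> i)" for \<alpha> :: "'n \<Rightarrow> nat"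
    using assms by (simp add: sum.remove[of UNIV e] sum.remove[of "UNIV - {e}" e'] Diff_insert2[symmetric] insert_commute)
  have "card ?I \<le> card ?P"
  proof (rule card_inj_on_le)
    show "inj_on (\<lambda>\<alpha>. (\<alpha> e, restrict \<alpha> (UNIV - {e, e'}))) ?I"
    proof (rule inj_onI)
      fix \<alpha> \<beta> assume \<alpha>: "\<alpha> \<in> ?I" and \<beta>: "\<beta> \<in> ?I"
        and eq: "(\<alpha> e, restrict \<alpha> (UNIV - {e, e'})) = (\<beta> e, restrict \<beta> (UNIV - {e, e'}))"
      then have same: "\<alpha> e = \<beta> e" "\<And>i. i \<noteq> e \<Longrightarrow> i \<noteq> e' \<Longrightarrow> \<alpha> i = \<beta> i"
        by (auto simp: restrict_def fun_eq_iff split: if_splits)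
      then have "(\<Sum>i\<in>UNIV - {e, e'}. \<alpha> i) = (\<Sum>i\<in>UNIV - {e, e'}. \<beta> i)" by (intro sum.cong) auto
      with \<alpha> \<beta> same split[of \<alpha>] split[of \<beta>] have "\<alpha> e' = \<beta> e'" by simp
      with same show "\<alpha> = \<beta>" by (metis ext)
    qed
    show "(\<lambda>\<alpha>. (\<alpha> e, restrict \<alpha> (UNIV - {e, e'}))) ` ?I \<subseteq> ?P"
    proof -
      have "\<alpha> i \<le> t" if "\<alpha> \<in> ?I" for \<alpha> i using that by (auto intro: member_le_sum)
      then have "restrict \<alpha> (UNIV - {e, e'}) \<in> (UNIV - {e, e'}) \<rightarrow>\<^sub>E {..t}" if "\<alpha> \<in> ?I" for \<alpha>
        using that by (simp add: restrict_PiE_iff)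
      then show ?thesis by blast
    qed
    show "finite ?P" by (intro finite_cartesian_product finite_PiE) auto
  qed
  also have "card ?P = 2 * (t + 1) ^ card (UNIV - {e, e'})"
    by (simp add: card_cartesian_product card_PiE)
  also have "card (UNIV - {e, e'}) = CARD('n) - 2"
    using assms by (simp add: card_Diff_subset)
  finally show ?thesis .
qed

lemma partial_deriv_translation_invariant:
  assumes "\<And>x. f (x + v) = f x"
  shows "partial_deriv j f (x + v) = partial_deriv j f x"
proof -
  have "f (x + v + s *\<^sub>R axis j 1) = f (x + s *\<^sub>R axis j 1)" for s
    using assms[of "x + s *\<^sub>R axis j 1"] by (simp add: add_ac)
  then show ?thesis by (simp add: partial_deriv_def)
qed

text \<open>Uniqueness in the Cauchy problem: expanding \<open>f\<close> in powers of the coordinate \<open>e\<close>, the equation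
  \<open>\<Delta> f = 0\<close> expresses the coefficient of order \<open>k + 2\<close> through that of order \<open>k\<close>.\<close>
lemma harmonic_eq_0_if_low_order_coeffs_0:
  fixes f :: "real ^ 'n \<Rightarrow> real" and e :: 'n
  assumes f: "\<And>x. f x = (\<Sum>\<alpha> | (\<Sum>i\<in>UNIV. \<alpha> i) = t. c \<alpha> * (\<Prod>i\<in>UNIV. (x $ i) ^ \<alpha> i))"
    and harm: "\<And>x. laplacian f x = 0"
    and low: "\<And>\<alpha>. (\<Sum>i\<in>UNIV. \<alpha> i) = t \<Longrightarrow> \<alpha> e \<le> 1 \<Longrightarrow> c \<alpha> = 0"
  shows "f x = 0"
proof -
  define G where "G = (\<lambda>k x. \<Sum>\<alpha> | (\<Sum>i\<in>UNIV. \<alpha> i) = t \<and> \<alpha> e = k. c \<alpha> * (\<Prod>i\<in>UNIV - {e}. (x $ i) ^ \<alpha> i))"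
  \<comment> \<open>\<open>G k\<close> vanishes for \<open>k > t\<close>; carrying two extra powers
    makes the sum differentiated twice in \<open>e\<close> run exactly over \<open>k \<le> t\<close>
    after the index shift.\<close>
  define M where "M = t + 2"
  define L where "L = (\<lambda>k x. \<Sum>j\<in>UNIV - {e}. partial_deriv j (partial_deriv j (G k)) x)"
  have finA: "finite {\<alpha> :: 'n \<Rightarrow> nat. (\<Sum>i\<in>UNIV. \<alpha> i) = t \<and> P \<alpha>}" for P
    by (rule finite_subset[OF _ finite_exponents[of t]]) auto
  have G_poly: "real_polynomial_function (G k)" for k
    unfolding G_def
    by (intro real_polynomial_function_sum real_polynomial_function.intros(2,4) real_polynomial_function_prod
        real_polynomial_function_power real_polynomial_function.intros(1) bounded_linear_vec_nth finA) auto
  have G_inv: "G k (x + s *\<^sub>R axis e 1) = G k x" for k s x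
    unfolding G_def by (intro sum.cong prod.cong arg_cong2[of _ _ _ _ "(*)"] refl) (auto simp: axis_def)
  have L_inv: "L k (x + s *\<^sub>R axis e 1) = L k x" for k s x
    unfolding L_def by (intro sum.cong refl partial_deriv_translation_invariant G_inv)
  have deg: "\<alpha> e \<le> t" if "(\<Sum>i\<in>UNIV. \<alpha> i) = t" for \<alpha> :: "'n \<Rightarrow> nat"
    using that by (auto intro: member_le_sum)
  have G_high: "G k = (\<lambda>x. 0)" if "k > t" for k
  proof -
    have "{\<alpha> :: 'n \<Rightarrow> nat. (\<Sum>i\<in>UNIV. \<alpha> i) = t \<and> \<alpha> e = k} = {}"
      using deg that by (metis (mono_tags, lifting) Collect_empty_eq leD)
    then show ?thesis unfolding G_def by (simp only: sum.empty)
  qed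
  have f_G: "f x = (\<Sum>k\<le>M. (x $ e) ^ k * G k x)" for x
  proof -
    have "f x = (\<Sum>k\<le>M. \<Sum>\<alpha> | \<alpha> \<in> {\<alpha>. (\<Sum>i\<in>UNIV. \<alpha> i) = t} \<and> \<alpha> e = k. c \<alpha> * (\<Prod>i\<in>UNIV. (x $ i) ^ \<alpha> i))"
      unfolding f by (rule sum.group[symmetric]) (use deg finite_exponents in \<open>force intro: le_SucI simp: M_def\<close>)+
    also have "\<dots> = (\<Sum>k\<le>M. (x $ e) ^ k * G k x)"
      unfolding G_def sum_distrib_left
      by (intro sum.cong) (auto simp: prod.remove[of UNIV e])
    finally show ?thesis .
  qed
  have xe: "(x + s *\<^sub>R axis e 1) $ e = x $ e + s" for x :: "real ^ 'n" and s
    by (simp add: axis_def)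
  \<comment> \<open>Arbitrary coefficients and exponents allow a second application to the result of
    the first. Truncated subtraction is harmless: at exponent 0 the factor \<open>p k\<close> is
    0.\<close>
  have D_e: "partial_deriv e (\<lambda>x. \<Sum>k\<le>M. (a k * (x $ e) ^ p k) * G k x) = (\<lambda>x. \<Sum>k\<le>M. (a k * (p k * (x $ e) ^ (p k - 1))) * G k x)"
    for a :: "nat \<Rightarrow> real" and p :: "nat \<Rightarrow> nat"
    by (rule ext, rule partial_deriv_eqI, unfold xe G_inv)
      (auto intro!: DERIV_sum derivative_eq_intros)
  have De: "partial_deriv e f = (\<lambda>x. \<Sum>k\<le>M. (k * (x $ e) ^ (k - 1)) * G k x)"
    using D_e[of "\<lambda>_. 1" "\<lambda>k. k"] by (simp add: f_G[abs_def])
  have Dee: "partial_deriv e (partial_deriv e f) = (\<lambda>x. \<Sum>k\<le>M. (k * ((k - 1) * (x $ e) ^ (k - 1 - 1))) * G k x)"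
    unfolding De D_e by simp
  have Dj: "partial_deriv j (\<lambda>x. \<Sum>k\<le>M. (x $ e) ^ k * H k x) = (\<lambda>x. \<Sum>k\<le>M. (x $ e) ^ k * partial_deriv j (H k) x)"
    if "j \<noteq> e" "\<And>k. real_polynomial_function (H k)" for j H
  proof (rule ext, rule partial_deriv_eqI)
    fix x :: "real ^ 'n"
    have "((\<lambda>s. H k (x + s *\<^sub>R axis j 1)) has_field_derivative partial_deriv j (H k) x) (at 0)" for k
      using DERIV_partial_deriv[OF that(2), where x = x and i = j and s = 0] by simp
    then show "((\<lambda>s. \<Sum>k\<le>M. ((x + s *\<^sub>R axis j 1) $ e) ^ k * H k (x + s *\<^sub>R axis j 1)) has_field_derivative
        (\<Sum>k\<le>M. (x $ e) ^ k * partial_deriv j (H k) x)) (at 0)"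
      using that(1) by (auto simp: axis_def intro!: DERIV_sum DERIV_cmult)
  qed
  have f_eq: "f = (\<lambda>x. \<Sum>k\<le>M. (x $ e) ^ k * G k x)" by (rule ext) (rule f_G)
  have lap: "laplacian f x = (\<Sum>k\<le>t. ((k + 2) * (k + 1) * G (k + 2) x + L k x) * (x $ e) ^ k)" for x
  proof -
    have "laplacian f x = partial_deriv e (partial_deriv e f) x + (\<Sum>j\<in>UNIV - {e}. partial_deriv j (partial_deriv j f) x)"
      by (simp add: laplacian_def sum.remove[of UNIV e])
    also have "(\<Sum>j\<in>UNIV - {e}. partial_deriv j (partial_deriv j f) x) =
        (\<Sum>j\<in>UNIV - {e}. \<Sum>k\<le>M. (x $ e) ^ k * partial_deriv j (partial_deriv j (G k)) x)"
      by (rule sum.cong) (simp_all add: f_eq Dj G_poly polynomial_partial_deriv)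
    also have "\<dots> = (\<Sum>k\<le>M. (x $ e) ^ k * L k x)"
      by (subst sum.swap) (simp add: L_def sum_distrib_left)
    also have "\<dots> = (\<Sum>k\<le>t. (x $ e) ^ k * L k x)"
      by (simp add: L_def G_high M_def)
    also have "partial_deriv e (partial_deriv e f) x = (\<Sum>k\<le>t. ((k + 2) * (k + 1) * (x $ e) ^ k) * G (k + 2) x)"
      unfolding Dee M_def add_2_eq_Suc' sum.atMost_Suc_shift by simp (simp add: algebra_simps)
    finally show ?thesis
      by (simp add: sum.distrib[symmetric] algebra_simps)
  qed
  \<comment> \<open>Moving along axis \<open>e\<close> gives coordinate \<open>e\<close> any value
    \<open>s\<close> but leaves \<open>G\<close> and \<open>L\<close> unchanged. The Laplacian is
    then a polynomial in \<open>s\<close> that vanishes identically, so each coefficient is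
    0.\<close>
  have rec: "real ((k + 2) * (k + 1)) * G (k + 2) x + L k x = 0" if "k \<le> t" for k x
  proof -
    have "(\<Sum>k\<le>t. ((k + 2) * (k + 1) * G (k + 2) x + L k x) * s ^ k) = 0" for s
      using harm[of "x + (s - x $ e) *\<^sub>R axis e 1"] unfolding lap G_inv L_inv xe by simp
    then show ?thesis using that polyfun_eq_0[where c = "\<lambda>k. (k + 2) * (k + 1) * G (k + 2) x + L k x" and n = t] by blast
  qed
  have "G k = (\<lambda>x. 0)" for k
  proof (induction k rule: less_induct)
    case (less k)
    consider "k \<le> 1" | "k > t" | "k \<ge> 2" "k \<le> t" by linarith
    then show ?case
    proof cases
      case 1
      then show ?thesis using low by (auto simp: G_def fun_eq_iff intro!: sum.neutral)
    next
      case 3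
      then obtain j where j: "k = j + 2" using le_Suc_ex[of 2 k] by (auto simp: add.commute)
      then have "L j x = 0" for x using less[of j] by (simp add: L_def)
      then have "real ((j + 2) * (j + 1)) * G (j + 2) x = 0" for x
        using rec[of j x] 3 j by simp
      moreover have "real ((j + 2) * (j + 1)) \<noteq> 0" by (simp only: of_nat_eq_0_iff) simp
      ultimately show ?thesis using j by (simp only: mult_eq_0_iff fun_eq_iff simp_thms)
    qed (rule G_high)
  qed
  then show ?thesis by (simp add: f_G)
qed

lemma laplacian_sum:
  fixes \<phi> :: "'k \<Rightarrow> real ^ 'n \<Rightarrow> real"
  assumes "finite K" "\<And>k. k \<in> K \<Longrightarrow> real_polynomial_function (\<phi> k)"
  shows "laplacian (\<lambda>x. \<Sum>k\<in>K. a k * \<phi> k x) x = (\<Sum>k\<in>K. a k * laplacian (\<phi> k) x)"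
proof -
  have *: "partial_deriv i (\<lambda>x. \<Sum>k\<in>K. a k * \<psi> k x) = (\<lambda>x. \<Sum>k\<in>K. a k * partial_deriv i (\<psi> k) x)"
    if "\<And>k. k \<in> K \<Longrightarrow> real_polynomial_function (\<psi> k)" for i and \<psi> :: "'k \<Rightarrow> real ^ 'n \<Rightarrow> real"
  proof (rule ext, rule partial_deriv_eqI)
    fix x :: "real ^ 'n"
    have "((\<lambda>s. \<psi> k (x + s *\<^sub>R axis i 1)) has_field_derivative partial_deriv i (\<psi> k) x) (at 0)" if "k \<in> K" for k
      using DERIV_partial_deriv[OF \<open>\<And>k. k \<in> K \<Longrightarrow> real_polynomial_function (\<psi> k)\<close>[OF that], where x = x and i = i and s = 0] by simp
    then show "((\<lambda>s. \<Sum>k\<in>K. a k * \<psi> k (x + s *\<^sub>R axis i 1)) has_field_derivative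
        (\<Sum>k\<in>K. a k * partial_deriv i (\<psi> k) x)) (at 0)"
      by (intro DERIV_sum DERIV_cmult)
  qed
  show ?thesis
    unfolding laplacian_def
    by (simp add: * assms polynomial_partial_deriv sum_distrib_left) (rule sum.swap)
qed

lemma Harm_sum:
  fixes \<phi> :: "'k \<Rightarrow> real ^ 'n \<Rightarrow> real"
  assumes "finite K" "\<And>k. k \<in> K \<Longrightarrow> \<phi> k \<in> Harm t"
  shows "(\<lambda>x. \<Sum>k\<in>K. a k * \<phi> k x) \<in> Harm t"
proof -
  have "\<forall>k\<in>K. \<exists>c :: ('n \<Rightarrow> nat) \<Rightarrow> real. \<forall>x.
        \<phi> k x = (\<Sum>\<alpha> | (\<Sum>i\<in>UNIV. \<alpha> i) = t. c \<alpha> * (\<Prod>i\<in>UNIV. (x $ i) ^ \<alpha> i))"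
    using assms by (auto simp: Harm_def homogeneous_polynomial_def)
  then obtain c :: "'k \<Rightarrow> ('n \<Rightarrow> nat) \<Rightarrow> real" where c: "\<And>k x. k \<in> K \<Longrightarrow>
        \<phi> k x = (\<Sum>\<alpha> | (\<Sum>i\<in>UNIV. \<alpha> i) = t. c k \<alpha> * (\<Prod>i\<in>UNIV. (x $ i) ^ \<alpha> i))"
    by metis
  have "(\<Sum>k\<in>K. a k * \<phi> k x) =
      (\<Sum>\<alpha> | (\<Sum>i\<in>UNIV. \<alpha> i) = t. (\<Sum>k\<in>K. a k * c k \<alpha>) * (\<Prod>i\<in>UNIV. (x $ i) ^ \<alpha> i))" for x
    by (simp add: c sum_distrib_left sum_distrib_right mult.assoc) (rule sum.swap)
  then have "homogeneous_polynomial t (\<lambda>x. \<Sum>k\<in>K. a k * \<phi> k x)"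
    unfolding homogeneous_polynomial_def by (intro exI[of _ "\<lambda>\<alpha>. \<Sum>k\<in>K. a k * c k \<alpha>"] allI)
  moreover have "laplacian (\<lambda>x. \<Sum>k\<in>K. a k * \<phi> k x) x = 0" for x
  proof (subst laplacian_sum)
    show "real_polynomial_function (\<phi> k)" if "k \<in> K" for k
      using assms(2)[OF that] by (auto simp: Harm_def intro: homogeneous_polynomial_imp_polynomial)
  qed (use assms in \<open>auto simp: Harm_def\<close>)
  ultimately show ?thesis by (simp add: Harm_def)
qed

text \<open>There are more polynomials than Cauchy data, so some nontrivial combination has all
  coefficients with \<open>\<alpha> e \<le> 1\<close> equal to 0; uniqueness in the Cauchy problem
  makes it vanish.\<close>

lemma Harm_dependent:
  fixes \<phi> :: "nat \<Rightarrow> real ^ 'n \<Rightarrow> real"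
  assumes n: "CARD('n) \<ge> 2" and \<phi>: "\<And>k. k < m \<Longrightarrow> \<phi> k \<in> Harm t"
    and m: "m > 2 * (t + 1) ^ (CARD('n) - 2)"
  shows "\<exists>a. (\<exists>k<m. a k \<noteq> 0) \<and> (\<forall>x. (\<Sum>k<m. a k * \<phi> k x) = 0)"
proof -
  obtain e e' :: 'n where e: "e \<noteq> e'"
    using n card_le_Suc0_iff_eq[of "UNIV :: 'n set"] by fastforce
  let ?I = "{\<alpha> :: 'n \<Rightarrow> nat. (\<Sum>i\<in>UNIV. \<alpha> i) = t \<and> \<alpha> e \<le> 1}"
  have "\<forall>k. \<exists>c :: ('n \<Rightarrow> nat) \<Rightarrow> real. k < m \<longrightarrow> (\<forall>x.
        \<phi> k x = (\<Sum>\<alpha> | (\<Sum>i\<in>UNIV. \<alpha> i) = t. c \<alpha> * (\<Prod>i\<in>UNIV. (x $ i) ^ \<alpha> i)))"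
    using \<phi> by (auto simp: Harm_def homogeneous_polynomial_def)
  then obtain c :: "nat \<Rightarrow> ('n \<Rightarrow> nat) \<Rightarrow> real" where c: "\<And>k x. k < m \<Longrightarrow>
        \<phi> k x = (\<Sum>\<alpha> | (\<Sum>i\<in>UNIV. \<alpha> i) = t. c k \<alpha> * (\<Prod>i\<in>UNIV. (x $ i) ^ \<alpha> i))"
    by metis
  have "finite ?I" by (rule finite_subset[OF _ finite_exponents[of t]]) auto
  moreover have "card ?I < card {..<m}"
    using card_exponents_le[OF e, of t] m by simp
  ultimately obtain a where a: "\<exists>k\<in>{..<m}. a k \<noteq> 0" "\<And>\<alpha>. \<alpha> \<in> ?I \<Longrightarrow> (\<Sum>k<m. a k * c k \<alpha>) = 0"
    using homogeneous_system_nontrivial_solution[of ?I "{..<m}" c] by auto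
  have "(\<Sum>k<m. a k * \<phi> k x) = 0" for x
  proof (rule harmonic_eq_0_if_low_order_coeffs_0[where f = "\<lambda>x. \<Sum>k<m. a k * \<phi> k x" and c = "\<lambda>\<alpha>. \<Sum>k<m. a k * c k \<alpha>" and e = e and t = t])
    show "(\<Sum>k<m. a k * \<phi> k x) =
      (\<Sum>\<alpha> | (\<Sum>i\<in>UNIV. \<alpha> i) = t. (\<Sum>k<m. a k * c k \<alpha>) * (\<Prod>i\<in>UNIV. (x $ i) ^ \<alpha> i))" for x
      by (simp add: c sum_distrib_left sum_distrib_right mult.assoc) (rule sum.swap)
    show "laplacian (\<lambda>x. \<Sum>k<m. a k * \<phi> k x) x = 0" for x
      using Harm_sum[of "{..<m}" \<phi> t a] \<phi> by (simp add: Harm_def)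
  qed (use a(2) in auto)
  with a(1) show ?thesis by blast
qed

subsection \<open>Zeros of outward pointing maps\<close>

text \<open>Without a zero, the normalised map \<open>T (F (R * x))\<close> would be homotopic to
  the identity of the sphere, along segments which keep a positive inner product with
  \<open>x\<close>, and also to a constant, by shrinking the radius to 0. Vectors are functions on
  \<open>nat\<close> cut off at \<open>m\<close>, because the dimension is a number that varies with
  \<open>t\<close> and not a type.\<close>

lemma outward_pointing_map_has_zero:
  fixes F :: "(nat \<Rightarrow> real) \<Rightarrow> nat \<Rightarrow> real"
  assumes cont: "\<And>i. i < m \<Longrightarrow> continuous_on UNIV (\<lambda>v. F v i)"
    and R: "R > 0"
    and out: "\<And>v. (\<Sum>i<m. (v i)\<^sup>2) = R\<^sup>2 \<Longrightarrow> (\<And>i. i \<ge> m \<Longrightarrow> v i = 0) \<Longrightarrow> (\<Sum>i<m. v i * F v i) > 0"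
  shows "\<exists>v. \<forall>i<m. F v i = 0"
proof (rule ccontr)
  assume no: "\<not> ?thesis"
  then obtain n where m: "m = Suc n"
    by (cases m) auto
  define nrm where "nrm = (\<lambda>w::nat \<Rightarrow> real. sqrt (\<Sum>i<m. (w i)\<^sup>2))"
  define T where "T = (\<lambda>(w::nat \<Rightarrow> real) i. if i < m then w i / nrm w else 0)"
  define S where "S = {x::nat \<Rightarrow> real. (\<Sum>i\<le>n. (x i)\<^sup>2) = 1 \<and> (\<forall>i>n. x i = 0)}"
  have S_alt: "S = {x. (\<Sum>i<m. (x i)\<^sup>2) = 1 \<and> (\<forall>i\<ge>m. x i = 0)}"
    by (auto simp: S_def m lessThan_Suc_atMost)
  have nrm_pos: "nrm w > 0" if "\<exists>i<m. w i \<noteq> 0" for w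
  proof -
    from that obtain i where "i < m" "w i \<noteq> 0" by blast
    then have "0 < (\<Sum>i<m. (w i)\<^sup>2)"
      by (intro sum_pos2[of _ i]) auto
    then show ?thesis by (simp add: nrm_def)
  qed
  have T_in: "T w \<in> S" if "\<exists>i<m. w i \<noteq> 0" for w
  proof -
    have "(\<Sum>i<m. (T w i)\<^sup>2) = (\<Sum>i<m. (w i)\<^sup>2) / (nrm w)\<^sup>2"
      by (simp add: T_def power_divide sum_divide_distrib)
    also have "(nrm w)\<^sup>2 = (\<Sum>i<m. (w i)\<^sup>2)"
      by (simp add: nrm_def sum_nonneg)
    finally show ?thesis
      using nrm_pos[OF that] by (simp add: S_alt nrm_def T_def)
  qed
  have T_cont: "continuous_on A (\<lambda>x. T (g x))"
    if g: "\<And>i. i < m \<Longrightarrow> continuous_on A (\<lambda>x. g x i)" and nz: "\<And>x. x \<in> A \<Longrightarrow> \<exists>i<m. g x i \<noteq> 0"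
    for A :: "(real \<times> (nat \<Rightarrow> real)) set" and g
  proof (intro continuous_on_coordinatewise_then_product)
    fix i
    have "continuous_on A (\<lambda>x. nrm (g x))"
      unfolding nrm_def by (intro continuous_intros g) auto
    then show "continuous_on A (\<lambda>x. T (g x) i)"
      unfolding T_def using nrm_pos[OF nz] g
      by (cases "i < m") (auto intro!: continuous_intros simp: less_le)
  qed
  have proj: "continuous_on A (\<lambda>x. snd x i)" for A :: "(real \<times> (nat \<Rightarrow> real)) set" and i
    by (rule continuous_on_product_then_coordinatewise) (intro continuous_on_snd continuous_on_id)
  have scale: "continuous_on A (\<lambda>x. F (\<lambda>j. g x * snd x j) i)"
    if "i < m" "continuous_on A g" for A :: "(real \<times> (nat \<Rightarrow> real)) set" and g i
    by (rule continuous_on_compose2[OF cont[OF that(1)]])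
       (auto intro!: continuous_intros that proj continuous_on_coordinatewise_then_product)
  have T_id: "T x = x" if "x \<in> S" for x
    using that by (auto simp: T_def S_alt nrm_def fun_eq_iff)
  have S_out: "(\<Sum>i<m. x i * F (\<lambda>j. R * x j) i) > 0" if "x \<in> S" for x
  proof -
    have "(\<Sum>i<m. (R * x i) * F (\<lambda>j. R * x j) i) > 0"
      using that by (intro out) (auto simp: S_alt power_mult_distrib simp flip: sum_distrib_left)
    also have "(\<Sum>i<m. (R * x i) * F (\<lambda>j. R * x j) i) = R * (\<Sum>i<m. x i * F (\<lambda>j. R * x j) i)"
      by (simp add: sum_distrib_left mult.assoc)
    finally show ?thesis using R by (simp add: zero_less_mult_iff)
  qed
  have h1: "homotopic_with_canon (\<lambda>x. True) S S id (\<lambda>x. T (F (\<lambda>j. R * x j)))"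
  proof -
    define g where "g = (\<lambda>(z::real \<times> (nat \<Rightarrow> real)) i. (1 - fst z) * snd z i + fst z * F (\<lambda>j. R * snd z j) i)"
    have nz: "\<exists>i<m. g z i \<noteq> 0" if "z \<in> {0..1} \<times> S" for z
    proof (rule ccontr)
      assume "\<not> ?thesis"
      then have "(\<Sum>i<m. snd z i * g z i) = 0" by simp
      moreover have "(\<Sum>i<m. snd z i * g z i) =
          (1 - fst z) * (\<Sum>i<m. (snd z i)\<^sup>2) + fst z * (\<Sum>i<m. snd z i * F (\<lambda>j. R * snd z j) i)"
        unfolding g_def sum_distrib_left sum.distrib[symmetric]
        by (rule sum.cong) (simp_all add: algebra_simps power2_eq_square)
      moreover have "\<dots> = (1 - fst z) + fst z * (\<Sum>i<m. snd z i * F (\<lambda>j. R * snd z j) i)"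
        using that by (auto simp: S_alt)
      moreover have "\<dots> > 0"
        using that S_out[of "snd z"] by (cases "fst z = 0") (auto intro: add_nonneg_pos)
      ultimately show False by simp
    qed
    show ?thesis
    proof (subst homotopic_with; (intro exI[of _ "\<lambda>z. T (g z)"] conjI allI ballI)?)
      show "continuous_map (prod_topology (top_of_set {0..1}) (top_of_set S)) (top_of_set S) (\<lambda>z. T (g z))"
        using T_in nz
        by (auto simp flip: subtopology_Times intro!: T_cont) (auto simp: g_def intro!: continuous_intros proj scale)
      show "T (g (0, x)) = id x" if "x \<in> topspace (top_of_set S)" for x
        using that T_id by (auto simp: g_def T_def)
    qed (auto simp: g_def)
  qed
  have h2: "homotopic_with_canon (\<lambda>x. True) S S (\<lambda>x. T (F (\<lambda>j. R * x j))) (\<lambda>x. T (F (\<lambda>j. 0)))"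
  proof -
    define g where "g = (\<lambda>z::real \<times> (nat \<Rightarrow> real). F (\<lambda>j. (R * (1 - fst z)) * snd z j))"
    have nz: "\<exists>i<m. g z i \<noteq> 0" for z
      using no by (auto simp: g_def)
    show ?thesis
    proof (subst homotopic_with; (intro exI[of _ "\<lambda>z. T (g z)"] conjI allI ballI)?)
      show "continuous_map (prod_topology (top_of_set {0..1}) (top_of_set S)) (top_of_set S) (\<lambda>z. T (g z))"
        using T_in nz
        by (auto simp flip: subtopology_Times intro!: T_cont) (auto simp: g_def intro!: continuous_intros scale)
    qed (auto simp: g_def)
  qed
  have "contractible S"
    unfolding contractible_def using homotopic_with_trans[OF h1 h2] by blast
  moreover have "nsphere n = top_of_set S"
    by (simp add: nsphere S_def euclidean_product_topology)
  ultimately show False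
    using non_contractible_space_nsphere[of n] by simp
qed

subsection \<open>Sparse weights depending continuously on a linear functional\<close>

text \<open>Weights on the moment curve, \<open>c j = z ^ j\<close>: every \<open>a\<close> gives a
  nonzero polynomial in \<open>z\<close>, and finitely many polynomials leave some \<open>z\<close>
  between 0 and 1 that is a root of none.\<close>

lemma ex_generic_weights:
  fixes V :: "(nat \<Rightarrow> real) set"
  assumes "finite V" and nz: "\<And>a. a \<in> V \<Longrightarrow> \<exists>j<k. a j \<noteq> 0"
  shows "\<exists>c. (\<forall>j. 0 \<le> c j \<and> c j \<le> (1::real)) \<and> (\<forall>a\<in>V. (\<Sum>j<k. a j * c j) \<noteq> 0)"
proof -
  have "finite {z::real. (\<Sum>j<k. a j * z ^ j) = 0}" if a: "a \<in> V" for a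
  proof -
    define b where "b = (\<lambda>j. if j < k then a j else 0)"
    obtain j where j: "j < k" "a j \<noteq> 0" using nz[OF a] by blast
    have "(\<Sum>j<k. a j * z ^ j) = (\<Sum>j\<le>k. b j * z ^ j)" for z
      by (simp add: b_def flip: lessThan_Suc_atMost)
    moreover have "finite {z. (\<Sum>j\<le>k. b j * z ^ j) = 0}"
      using j by (intro polyfun_roots_finite[of b j]) (auto simp: b_def)
    ultimately show ?thesis by simp
  qed
  then have "finite (\<Union>a\<in>V. {z. (\<Sum>j<k. a j * z ^ j) = 0})" using assms(1) by blast
  then have "infinite ({0<..<1::real} - (\<Union>a\<in>V. {z. (\<Sum>j<k. a j * z ^ j) = 0}))"
    by (intro Diff_infinite_finite infinite_Ioo) auto
  then have "{0<..<1::real} - (\<Union>a\<in>V. {z. (\<Sum>j<k. a j * z ^ j) = 0}) \<noteq> {}"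
    by (metis finite.emptyI)
  then obtain z where "z \<in> {0<..<1::real} - (\<Union>a\<in>V. {z. (\<Sum>j<k. a j * z ^ j) = 0})"
    by blast
  then have z: "0 < z" "z < 1" "\<And>a. a \<in> V \<Longrightarrow> (\<Sum>j<k. a j * z ^ j) \<noteq> 0"
    by auto
  then show ?thesis by (intro exI[of _ "\<lambda>j. z ^ j"]) (auto simp: power_le_one)
qed

text \<open>\<open>p j i\<close> is the value of the \<open>i\<close>-th function at the \<open>j\<close>-th point.  The weights maximise over the simplex the
  linear functional given by \<open>v\<close> minus half the squared norm of the barycentre plus a generic linear
  functional.  Genericity makes the maximiser unique, hence continuous in \<open>v\<close>, and its support affinely
  independent, hence small.\<close>
lemma continuous_sparse_weights:
  fixes p :: "nat \<Rightarrow> nat \<Rightarrow> real"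
  assumes k: "k \<ge> 1"
  obtains \<mu> :: "(nat \<Rightarrow> real) \<Rightarrow> nat \<Rightarrow> real" and B :: real
  where "\<And>j. continuous_on UNIV (\<lambda>v. \<mu> v j)" "\<And>v j. \<mu> v j \<ge> 0" "\<And>v. (\<Sum>j<k. \<mu> v j) = 1"
    "\<And>v. card {j. j < k \<and> \<mu> v j > 0} \<le> m + 1"
    "\<And>v j l. j < k \<Longrightarrow> \<mu> v j > 0 \<Longrightarrow> l < k \<Longrightarrow> (\<Sum>i<m. v i * p l i) \<le> (\<Sum>i<m. v i * p j i) + B"
proof -
  define \<Delta> where "\<Delta> = {\<mu>::nat \<Rightarrow> real. (\<forall>j. 0 \<le> \<mu> j) \<and> (\<forall>j\<ge>k. \<mu> j = 0) \<and> (\<Sum>j<k. \<mu> j) = 1}"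
  define bar where "bar = (\<lambda>(\<mu>::nat \<Rightarrow> real) i. \<Sum>j<k. \<mu> j * p j i)"
  define val where "val = (\<lambda>(v::nat \<Rightarrow> real) j. \<Sum>i<m. v i * p j i)"
  define dep where "dep = (\<lambda>a T. (\<exists>j<k. a j \<noteq> 0) \<and> (\<forall>j. j \<notin> T \<longrightarrow> a j = 0) \<and> (\<Sum>j<k. a j) = 0 \<and> (\<forall>i<m. bar a i = 0))"
  \<comment> \<open>\<open>dep a T\<close> makes \<open>a\<close> an affine dependence supported in
    \<open>T\<close>. Choosing one per support reduces genericity of \<open>c\<close> to finitely
    many conditions.\<close>
  define aT where "aT = (\<lambda>T. SOME a. dep a T)"
  have aT: "dep (aT T) T" if "dep a T" for a T
    using someI[of "\<lambda>a. dep a T"] that by (simp add: aT_def)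
  define V where "V = aT ` {T. T \<subseteq> {..<k} \<and> (\<exists>a. dep a T)}"
  have "finite V" unfolding V_def by (rule finite_imageI, rule finite_subset[of _ "Pow {..<k}"]) auto
  moreover have "\<exists>j<k. a j \<noteq> 0" if "a \<in> V" for a
    using that aT by (auto simp: V_def dep_def)
  ultimately have "\<exists>c. (\<forall>j. 0 \<le> c j \<and> c j \<le> (1::real)) \<and> (\<forall>a\<in>V. (\<Sum>j<k. a j * c j) \<noteq> 0)"
    by (rule ex_generic_weights)
  then obtain c where c: "\<And>j. 0 \<le> c j" "\<And>j. c j \<le> (1::real)" "\<And>a. a \<in> V \<Longrightarrow> (\<Sum>j<k. a j * c j) \<noteq> 0"
    by metis
  define \<Phi> where "\<Phi> = (\<lambda>v \<mu>. (\<Sum>j<k. \<mu> j * val v j) - (\<Sum>i<m. (bar \<mu> i)\<^sup>2) / 2 + (\<Sum>j<k. \<mu> j * c j))"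
  define grad where "grad = (\<lambda>v \<mu> d. (\<Sum>j<k. d j * val v j) - (\<Sum>i<m. bar \<mu> i * bar d i) + (\<Sum>j<k. d j * c j))"
  define quad where "quad = (\<lambda>d. \<Sum>i<m. (bar d i)\<^sup>2)"
  have expand: "\<Phi> v (\<lambda>j. \<mu> j + s * d j) = \<Phi> v \<mu> + s * grad v \<mu> d - s\<^sup>2 / 2 * quad d" for v \<mu> d s
  proof -
    have bar_add: "bar (\<lambda>j. \<mu> j + s * d j) i = bar \<mu> i + s * bar d i" for i
      by (simp add: bar_def distrib_right sum.distrib sum_distrib_left mult.assoc)
    have lin: "(\<Sum>j<k. (\<mu> j + s * d j) * h j) = (\<Sum>j<k. \<mu> j * h j) + s * (\<Sum>j<k. d j * h j)" for h
      by (simp add: distrib_right sum.distrib sum_distrib_left mult.assoc)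
    have "(\<Sum>i<m. (bar \<mu> i + s * bar d i)\<^sup>2) = (\<Sum>i<m. (bar \<mu> i)\<^sup>2) + 2 * s * (\<Sum>i<m. bar \<mu> i * bar d i) + s\<^sup>2 * quad d"
      by (simp add: quad_def power2_sum sum.distrib sum_distrib_left power_mult_distrib mult_ac)
    then show ?thesis
      unfolding \<Phi>_def grad_def bar_add lin by (simp add: field_simps)
  qed
  have \<Delta>_compact: "compact \<Delta>"
  proof -
    have cP: "compact (PiE UNIV (\<lambda>_. {0..1}) :: (nat \<Rightarrow> real) set)"
      using compactin_PiE[of "\<lambda>_::nat. euclideanreal" UNIV "\<lambda>_. {0..1}"]
      by (simp add: euclidean_product_topology)
    have eq: "\<Delta> = PiE UNIV (\<lambda>_. {0..1}) \<inter> \<Delta>"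
    proof -
      have "\<mu> j \<le> 1" if "\<mu> \<in> \<Delta>" for \<mu> j
        using that member_le_sum[of j "{..<k}" \<mu>] by (cases "j < k") (auto simp: \<Delta>_def)
      then show ?thesis by (auto simp: \<Delta>_def)
    qed
    have cl: "closed \<Delta>"
    proof -
      have "closed ((\<Inter>j. {\<mu>. 0 \<le> \<mu> j}) \<inter> (\<Inter>j\<in>{k..}. {\<mu>. \<mu> j = 0}) \<inter> {\<mu>::nat \<Rightarrow> real. (\<Sum>j<k. \<mu> j) = 1})"
        by (intro closed_Int closed_INT ballI closed_Collect_le closed_Collect_eq continuous_on_sum
            continuous_on_product_coordinates continuous_on_const)
      also have "\<dots> = \<Delta>" by (auto simp: \<Delta>_def)
      finally show ?thesis .
    qed
    show ?thesis by (subst eq) (rule compact_Int_closed[OF cP cl])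
  qed
  have \<Delta>_ne: "\<Delta> \<noteq> {}"
  proof -
    have "(\<lambda>j. if j = 0 then 1 else 0) \<in> \<Delta>" using k by (auto simp: \<Delta>_def)
    then show ?thesis by blast
  qed
  have proj: "continuous_on A (\<lambda>z. fst z i)" "continuous_on A (\<lambda>z. snd z i)"
    for A :: "((nat \<Rightarrow> real) \<times> (nat \<Rightarrow> real)) set" and i
    by (rule continuous_on_product_then_coordinatewise; intro continuous_on_fst continuous_on_snd continuous_on_id)+
  have \<Phi>_cont2: "continuous_on A (\<lambda>z. \<Phi> (fst z) (snd z))" for A
    unfolding \<Phi>_def val_def bar_def by (intro continuous_intros proj) auto
  have \<Phi>_cont1: "continuous_on A (\<lambda>z. \<Phi> (fst z) \<nu>)" for A :: "((nat \<Rightarrow> real) \<times> (nat \<Rightarrow> real)) set" and \<nu>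
    unfolding \<Phi>_def val_def bar_def by (intro continuous_intros proj) auto
  have \<Phi>_cont: "continuous_on \<Delta> (\<Phi> v)" for v
  proof -
    have "continuous_on \<Delta> (\<lambda>\<mu>. \<Phi> (fst (v, \<mu>)) (snd (v, \<mu>)))"
      by (rule continuous_on_compose2[OF \<Phi>_cont2[of UNIV]]) (auto intro!: continuous_intros)
    then show ?thesis by simp
  qed
  define opt where "opt = (\<lambda>v \<mu>. \<mu> \<in> \<Delta> \<and> (\<forall>\<nu>\<in>\<Delta>. \<Phi> v \<nu> \<le> \<Phi> v \<mu>))"
  have opt_ex: "\<exists>\<mu>. opt v \<mu>" for v
    using continuous_attains_sup[OF \<Delta>_compact \<Delta>_ne \<Phi>_cont[of v]] by (auto simp: opt_def)
  have quad_nonneg: "quad d \<ge> 0" for d by (simp add: quad_def sum_nonneg)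
  have grad_le: "grad v \<mu> d \<le> 0" if "opt v \<mu>" and s0: "s0 > 0" "(\<lambda>j. \<mu> j + s0 * d j) \<in> \<Delta>" for v \<mu> d s0
  proof (rule ccontr)
    assume "\<not> ?thesis"
    then have g: "grad v \<mu> d > 0" by simp
    \<comment> \<open>So short a step gains more in first order, \<open>s * grad v \<mu> d\<close>,
      than the quadratic term \<open>s\<^sup>2 / 2 * quad d\<close> takes away.\<close>
    define s where "s = min s0 (grad v \<mu> d / (quad d + 1))"
    have q1: "quad d + 1 > 0" using quad_nonneg[of d] by simp
    have "0 < s" "s \<le> s0" "s \<le> grad v \<mu> d / (quad d + 1)"
      using g s0 q1 by (simp_all add: s_def)
    then have s: "0 < s" "s \<le> s0" "s * (quad d + 1) \<le> grad v \<mu> d"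
      using q1 by (simp_all add: pos_le_divide_eq)
    have "(\<lambda>j. \<mu> j + s * d j) \<in> \<Delta>"
    proof -
      have "0 \<le> \<mu> j + s * d j" for j
      proof -
        have "\<mu> j + s * d j = (1 - s / s0) * \<mu> j + s / s0 * (\<mu> j + s0 * d j)"
          using s0 by (simp add: field_simps)
        moreover have "\<mu> j \<ge> 0" "\<mu> j + s0 * d j \<ge> 0" using that by (auto simp: opt_def \<Delta>_def)
        ultimately show ?thesis using s s0 by (simp add: add_nonneg_nonneg)
      qed
      moreover have "(\<Sum>j<k. \<mu> j + s0 * d j) = 1" "(\<Sum>j<k. \<mu> j) = 1" using that by (auto simp: opt_def \<Delta>_def)
      then have "(\<Sum>j<k. d j) = 0" using s0 by (simp add: sum.distrib flip: sum_distrib_left)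
      moreover have "\<mu> j + s0 * d j = 0" "\<mu> j = 0" if "j \<ge> k" for j using \<open>opt v \<mu>\<close> s0(2) that by (auto simp: opt_def \<Delta>_def)
      then have "d j = 0" "\<mu> j = 0" if "j \<ge> k" for j using s0(1) that by force+
      ultimately show ?thesis
        using \<open>(\<Sum>j<k. \<mu> j) = 1\<close> by (simp add: \<Delta>_def sum.distrib flip: sum_distrib_left)
    qed
    then have "\<Phi> v (\<lambda>j. \<mu> j + s * d j) \<le> \<Phi> v \<mu>"
      using that by (simp add: opt_def)
    then have "\<Phi> v \<mu> + s * grad v \<mu> d - s\<^sup>2 / 2 * quad d \<le> \<Phi> v \<mu>"
      unfolding expand .
    then have "s * grad v \<mu> d \<le> s * (s / 2 * quad d)" by (simp add: power2_eq_square)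
    then have "grad v \<mu> d \<le> s / 2 * quad d" using s by simp
    also have "\<dots> < s * (quad d + 1)" 
    proof -
      have "0 \<le> s * quad d" using s quad_nonneg[of d] by simp
      then have "s * quad d / 2 < s * quad d + s" using s(1) by linarith
      then show ?thesis by (simp add: distrib_left)
    qed
    finally show False using s by simp
  qed
  \<comment> \<open>Along a dependence \<open>d\<close> of the support neither the barycentre nor
    the value of \<open>v\<close> changes, so the gradient is the generic number
    \<open>\<Sum>j<k. d j * c j\<close>, which is nonzero. Positive weights can be moved along both
    \<open>d\<close> and \<open>- d\<close>, and one of these directions would increase
    \<open>\<Phi>\<close>.\<close>
  have indep: "\<not> dep a {j. j < k \<and> \<mu> j > 0}" if opt: "opt v \<mu>" for v \<mu> a
  proof
    let ?T = "{j. j < k \<and> \<mu> j > 0}"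
    assume "dep a ?T"
    define d where "d = aT ?T"
    have d: "dep d ?T" using aT[OF \<open>dep a ?T\<close>] by (simp add: d_def)
    have cd: "(\<Sum>j<k. d j * c j) \<noteq> 0"
      using c(3)[of d] \<open>dep a ?T\<close> by (auto simp: d_def V_def)
    have "(\<Sum>j<k. d j * val v j) = (\<Sum>i<m. v i * bar d i)"
      by (simp add: val_def bar_def sum_distrib_left mult_ac) (rule sum.swap)
    then have grad_d: "grad v \<mu> d = (\<Sum>j<k. d j * c j)"
      using d by (simp add: grad_def dep_def)
    have grad_uminus: "grad v \<mu> (\<lambda>j. - d j) = - grad v \<mu> d"
      by (simp add: grad_def bar_def sum_negf)
    define D where "D = (\<Sum>j<k. \<bar>d j\<bar>) + 1"
    have D: "D > 0" by (simp add: D_def add_nonneg_pos sum_nonneg)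
    have dD: "\<bar>d j\<bar> \<le> D" if "j < k" for j
      using member_le_sum[of j "{..<k}" "\<lambda>j. \<bar>d j\<bar>"] that by (simp add: D_def)
    have "?T \<noteq> {}" using d by (auto simp: dep_def)
    then have Min: "Min (\<mu> ` ?T) > 0" "j \<in> ?T \<Longrightarrow> Min (\<mu> ` ?T) \<le> \<mu> j" for j by auto
    define s0 where "s0 = Min (\<mu> ` ?T) / D"
    have s0: "s0 > 0" using Min D by (simp add: s0_def)
    have "(\<lambda>j. \<mu> j + s0 * (\<sigma> * d j)) \<in> \<Delta>" if "\<bar>\<sigma>\<bar> = 1" for \<sigma>
    proof -
      have "0 \<le> \<mu> j + s0 * (\<sigma> * d j)" for j
      proof (cases "j \<in> ?T")
        case True
        have "\<bar>s0 * (\<sigma> * d j)\<bar> \<le> s0 * D"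
          using True dD[of j] s0 \<open>\<bar>\<sigma>\<bar> = 1\<close> by (simp add: abs_mult)
        also have "\<dots> \<le> \<mu> j" using Min(2)[OF True] D by (simp add: s0_def)
        finally show ?thesis by linarith
      next
        case False
        then have "d j = 0" using d by (auto simp: dep_def)
        then show ?thesis using opt by (auto simp: opt_def \<Delta>_def)
      qed
      moreover have "d j = 0" if "j \<ge> k" for j using d that by (auto simp: dep_def)
      ultimately show ?thesis
        using opt d by (auto simp: opt_def \<Delta>_def dep_def sum.distrib simp flip: sum_distrib_left)
    qed
    from this[of 1] this[of "-1"] have "grad v \<mu> d \<le> 0" "grad v \<mu> (\<lambda>j. - d j) \<le> 0"
      using grad_le[OF opt s0, of d] grad_le[OF opt s0, of "\<lambda>j. - d j"] by simp_all
    then show False using cd grad_d grad_uminus by simp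
  qed
  \<comment> \<open>The quadratic term forces two maximisers to have the same barycentre. Their
    difference is then a dependence on the support of their midpoint, which is a maximiser too,
    contrary to \<open>indep\<close>.\<close>
  have unique: "\<mu> = \<nu>" if \<mu>: "opt v \<mu>" and \<nu>: "opt v \<nu>" for v \<mu> \<nu>
  proof (rule ccontr)
    assume ne: "\<mu> \<noteq> \<nu>"
    define d where "d = (\<lambda>j. \<nu> j - \<mu> j)"
    have \<nu>_eq: "\<nu> = (\<lambda>j. \<mu> j + 1 * d j)" by (simp add: d_def)
    have "grad v \<mu> d \<le> 0" using grad_le[OF \<mu>, of 1 d] \<nu> by (simp add: d_def opt_def)
    moreover have "\<Phi> v \<nu> = \<Phi> v \<mu>" using \<mu> \<nu> by (auto simp: opt_def intro: antisym)
    then have "grad v \<mu> d - quad d / 2 = 0" using expand[of v \<mu> 1 d] \<nu>_eq by simp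
    ultimately have g0: "grad v \<mu> d = 0" "quad d = 0" using quad_nonneg[of d] by linarith+
    define \<kappa> where "\<kappa> = (\<lambda>j. \<mu> j + 1 / 2 * d j)"
    have \<mu>\<Delta>: "\<mu> \<in> \<Delta>" "\<nu> \<in> \<Delta>" using \<mu> \<nu> by (auto simp: opt_def)
    have "\<kappa> = (\<lambda>j. (\<mu> j + \<nu> j) / 2)" by (simp add: \<kappa>_def d_def field_simps)
    then have "\<kappa> \<in> \<Delta>" and \<kappa>_pos: "\<mu> j > 0 \<or> \<nu> j > 0 \<Longrightarrow> \<kappa> j > 0" for j
      using \<mu>\<Delta> by (auto simp: \<Delta>_def sum.distrib add_pos_nonneg add_nonneg_pos simp flip: sum_divide_distrib)
    moreover have "\<Phi> v \<kappa> = \<Phi> v \<mu>" using g0 expand[of v \<mu> "1/2" d] by (simp add: \<kappa>_def)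
    ultimately have \<kappa>: "opt v \<kappa>" using \<mu> by (simp add: opt_def)
    have "dep d {j. j < k \<and> \<kappa> j > 0}"
    proof -
      obtain j where j: "\<mu> j \<noteq> \<nu> j" using ne by blast
      then have "j < k" using \<mu>\<Delta> by (force simp: \<Delta>_def not_le[symmetric])
      moreover have "d j = 0" if "\<not> (j < k \<and> \<kappa> j > 0)" for j
      proof (cases "j < k")
        case True
        then have "\<not> \<mu> j > 0" "\<not> \<nu> j > 0" using that \<kappa>_pos by blast+
        then have "\<mu> j = 0" "\<nu> j = 0" using \<mu>\<Delta> by (auto simp: \<Delta>_def intro: antisym)
        then show ?thesis by (simp add: d_def)
      next
        case False
        then show ?thesis using \<mu>\<Delta> by (simp add: d_def \<Delta>_def)
      qed
      moreover have "(\<Sum>j<k. d j) = 0" using \<mu>\<Delta> by (simp add: d_def \<Delta>_def sum_subtractf)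
      moreover have "bar d i = 0" if "i < m" for i
        using g0(2) that by (simp add: quad_def sum_nonneg_eq_0_iff)
      ultimately show ?thesis using j by (auto simp: dep_def d_def)
    qed
    then show False using indep[OF \<kappa>] by blast
  qed
  define \<mu> where "\<mu> = (\<lambda>v. THE \<mu>. opt v \<mu>)"
  have opt_\<mu>: "opt v (\<mu> v)" for v
    unfolding \<mu>_def using opt_ex[of v] unique[of v] by (metis theI)
  have \<mu>\<Delta>: "\<mu> v \<in> \<Delta>" for v using opt_\<mu> by (simp add: opt_def)
  \<comment> \<open>Closed graph argument: the preimage of a closed \<open>T\<close> is the
    projection of the closed set \<open>W\<close> along the compact simplex, and such projections
    are closed maps.\<close>
  have \<mu>_cont: "continuous_on UNIV \<mu>"
    unfolding continuous_closedin_preimage_eq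
  proof (intro allI impI)
    fix T :: "(nat \<Rightarrow> real) set" assume T: "closed T"
    define W where "W = {z. (\<forall>\<nu>\<in>\<Delta>. \<Phi> (fst z) \<nu> \<le> \<Phi> (fst z) (snd z)) \<and> snd z \<in> T} \<inter> UNIV \<times> \<Delta>"
    have "closed {z. (\<forall>\<nu>\<in>\<Delta>. \<Phi> (fst z) \<nu> \<le> \<Phi> (fst z) (snd z)) \<and> snd z \<in> T}"
    proof (intro closed_Collect_conj)
      show "closed {z :: (nat \<Rightarrow> real) \<times> (nat \<Rightarrow> real). snd z \<in> T}"
        using closed_vimage[OF T, of snd] by (simp add: vimage_def continuous_on_snd)
      have "closed (\<Inter>\<nu>\<in>\<Delta>. {z. \<Phi> (fst z) \<nu> \<le> \<Phi> (fst z) (snd z)})"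
        by (intro closed_INT ballI closed_Collect_le \<Phi>_cont1 \<Phi>_cont2)
      then show "closed {z. \<forall>\<nu>\<in>\<Delta>. \<Phi> (fst z) \<nu> \<le> \<Phi> (fst z) (snd z)}"
        by (simp add: Collect_ball_eq)
    qed
    then have "closedin (prod_topology (top_of_set UNIV) (top_of_set \<Delta>)) W"
      unfolding prod_topology_subtopology_eu W_def closedin_closed by blast
    moreover have "closed_map (prod_topology (top_of_set UNIV) (top_of_set \<Delta>)) (top_of_set (UNIV :: (nat \<Rightarrow> real) set)) fst"
      by (intro Abstract_Topological_Spaces.closed_map_fst) (use \<Delta>_compact in \<open>simp add: compact_space_subtopology\<close>)
    ultimately have "closedin (top_of_set UNIV) (fst ` W)"
      unfolding closed_map_def by blast
    moreover have "fst ` W = UNIV \<inter> \<mu> -` T"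
    proof -
      have "z \<in> W \<longleftrightarrow> snd z = \<mu> (fst z) \<and> snd z \<in> T" for z
        using unique opt_\<mu>[of "fst z"] by (auto simp: W_def opt_def mem_Times_iff)
      then show ?thesis by force
    qed
    ultimately show "closedin (top_of_set UNIV) (UNIV \<inter> \<mu> -` T)" by (simp only:)
  qed
  define S where "S = (\<Sum>j<k. \<Sum>i<m. \<bar>p j i\<bar>)"
  have S: "\<bar>p j i\<bar> \<le> S" if "j < k" "i < m" for j i
  proof -
    have "\<bar>p j i\<bar> \<le> (\<Sum>i<m. \<bar>p j i\<bar>)" using that by (intro member_le_sum) auto
    also have "\<dots> \<le> S" unfolding S_def using that by (intro member_le_sum) (auto simp: sum_nonneg)
    finally show ?thesis .
  qed
  have barS: "\<bar>bar \<nu> i\<bar> \<le> S" if "\<nu> \<in> \<Delta>" "i < m" for \<nu> i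
  proof -
    have "\<bar>bar \<nu> i\<bar> \<le> (\<Sum>j<k. \<bar>\<nu> j * p j i\<bar>)" unfolding bar_def by (rule sum_abs)
    also have "\<dots> \<le> (\<Sum>j<k. \<nu> j * S)"
      using that S by (intro sum_mono) (auto simp: \<Delta>_def abs_mult mult_left_mono)
    also have "\<dots> = S" using that by (simp add: \<Delta>_def flip: sum_distrib_right)
    finally show ?thesis .
  qed
  \<comment> \<open>The error \<open>B\<close> comes from the first-order condition for moving all
    mass of atom \<open>j\<close> to \<open>l\<close>. The barycentre term contributes at most
    \<open>S * (2 * S)\<close> for each of \<open>m\<close> coordinates, the generic weights at most
    1; neither bound involves \<open>v\<close>.\<close>
  show thesis
  proof (rule that[of \<mu> "m * (S * (2 * S)) + 1"])
    show "continuous_on UNIV (\<lambda>v. \<mu> v j)" for j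
      by (rule continuous_on_product_then_coordinatewise[OF \<mu>_cont])
    show "\<mu> v j \<ge> 0" "(\<Sum>j<k. \<mu> v j) = 1" for v j using \<mu>\<Delta>[of v] by (auto simp: \<Delta>_def)
    show "card {j. j < k \<and> \<mu> v j > 0} \<le> m + 1" for v
    proof (rule ccontr)
      let ?T = "{j. j < k \<and> \<mu> v j > 0}"
      assume "\<not> ?thesis"
      \<comment> \<open>There are \<open>m + 1\<close> equations: indices below \<open>m\<close> are
        barycentre coordinates, index \<open>m\<close> is the total weight.\<close>
      then obtain a where a: "\<exists>j\<in>?T. a j \<noteq> 0" "\<And>j. j \<notin> ?T \<Longrightarrow> a j = 0"
        "\<And>i. i \<le> m \<Longrightarrow> (\<Sum>j\<in>?T. a j * (if i < m then p j i else 1)) = 0"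
        using homogeneous_system_nontrivial_solution[of "{..m}" ?T "\<lambda>j i. if i < m then p j i else 1"] by auto
      have T: "(\<Sum>j\<in>?T. a j * h j) = (\<Sum>j<k. a j * h j)" for h :: "nat \<Rightarrow> real"
        by (rule sum.mono_neutral_left) (use a(2) in auto)
      have "(\<Sum>j<k. a j) = 0" using a(3)[of m] T[of "\<lambda>_. 1"] by simp
      moreover have "bar a i = 0" if "i < m" for i
        using a(3)[of i] T[of "\<lambda>j. p j i"] that by (simp add: bar_def)
      ultimately have "dep a ?T" using a(1,2) unfolding dep_def by blast
      then show False using indep[OF opt_\<mu>] by blast
    qed
    fix v j l assume j: "j < k" "\<mu> v j > 0" and l: "l < k"
    show "(\<Sum>i<m. v i * p l i) \<le> (\<Sum>i<m. v i * p j i) + (m * (S * (2 * S)) + 1)"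
    proof (cases "j = l")
      case True
      have "0 \<le> S" by (simp add: S_def sum_nonneg)
      then show ?thesis using True by simp
    next
      case False
      define d where "d = (\<lambda>q. if q = l then 1 else if q = j then -1 else (0::real))"
      have sum_d: "(\<Sum>q<k. d q * h q) = h l - h j" for h
      proof -
        have "(\<Sum>q<k. d q * h q) = (\<Sum>q<k. (if q = l then h q else 0) - (if q = j then h q else 0))"
          by (rule sum.cong) (use False in \<open>auto simp: d_def\<close>)
        also have "\<dots> = h l - h j" using j l by (simp add: sum_subtractf)
        finally show ?thesis .
      qed
      have "(\<lambda>q. \<mu> v q + \<mu> v j * d q) \<in> \<Delta>"
      proof -
        have "(\<Sum>q<k. d q) = 0" using sum_d[of "\<lambda>_. 1"] by simp
        then have "(\<Sum>q<k. \<mu> v q + \<mu> v j * d q) = 1"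
          using \<mu>\<Delta>[of v] by (simp add: \<Delta>_def sum.distrib flip: sum_distrib_left)
        moreover have "0 \<le> \<mu> v q + \<mu> v j * d q" for q
          using \<mu>\<Delta>[of v] by (simp add: d_def \<Delta>_def)
        moreover have "\<mu> v q + \<mu> v j * d q = 0" if "q \<ge> k" for q
          using \<mu>\<Delta>[of v] that j l by (simp add: d_def \<Delta>_def)
        ultimately show ?thesis by (simp add: \<Delta>_def)
      qed
      then have "grad v (\<mu> v) d \<le> 0" using grad_le[OF opt_\<mu>] j by blast
      moreover have bar_d: "bar d i = p l i - p j i" for i by (simp add: bar_def sum_d)
      then have "grad v (\<mu> v) d = val v l - val v j - (\<Sum>i<m. bar (\<mu> v) i * (p l i - p j i)) + (c l - c j)"
        unfolding grad_def sum_d bar_d by simp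
      moreover have "(\<Sum>i<m. bar (\<mu> v) i * (p l i - p j i)) \<le> (\<Sum>i<m. S * (2 * S))"
      proof (rule sum_mono)
        fix i assume i: "i \<in> {..<m}"
        have "bar (\<mu> v) i * (p l i - p j i) \<le> \<bar>bar (\<mu> v) i\<bar> * \<bar>p l i - p j i\<bar>"
          by (metis abs_ge_self abs_mult)
        also have "\<dots> \<le> S * (2 * S)"
          using barS[OF \<mu>\<Delta>, of i v] S[of l i] S[of j i] i j l by (intro mult_mono) auto
        finally show "bar (\<mu> v) i * (p l i - p j i) \<le> S * (2 * S)" .
      qed
      ultimately show ?thesis using c(1)[of l] c(2)[of j] by (simp add: val_def)
    qed
  qed
qed

subsection \<open>Quantile positions\<close>

text \<open>The shift by \<open>1 / 2\<close> keeps all levels at distance at least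
  \<open>1 / (2 * N)\<close> from 0 and 1.\<close>

definition quantile :: "nat \<Rightarrow> nat \<Rightarrow> real" where
  "quantile N l = (real l + 1 / 2) / real N"

text \<open>A continuous version of the quantile function of the discrete measure \<open>\<mu>\<close>: it equals the atom \<open>j\<close>
  carrying the \<open>l\<close>-th quantile, except that it moves linearly from one atom to the next while that quantile
  exceeds a jump of the distribution function by less than \<open>1 / (4 * N)\<close>.\<close>
definition quantile_position :: "nat \<Rightarrow> nat \<Rightarrow> (nat \<Rightarrow> real) \<Rightarrow> nat \<Rightarrow> real" where
  "quantile_position k N \<mu> l = (\<Sum>j<k. max 0 (min 1 ((quantile N l - (\<Sum>i\<le>j. \<mu> i)) * (4 * real N))))"

lemma quantile_position_mono: "l \<le> l' \<Longrightarrow> quantile_position k N \<mu> l \<le> quantile_position k N \<mu> l'"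
  unfolding quantile_position_def quantile_def
  by (intro sum_mono max.mono min.mono mult_right_mono diff_right_mono divide_right_mono) auto

lemma quantile_position_nonneg: "quantile_position k N \<mu> l \<ge> 0"
  unfolding quantile_position_def by (intro sum_nonneg) auto

lemma continuous_on_quantile_position:
  assumes "\<And>j. continuous_on A (\<lambda>v. \<mu> v j)"
  shows "continuous_on A (\<lambda>v. quantile_position k N (\<mu> v) l)"
  unfolding quantile_position_def by (intro continuous_intros assms)

lemma clamp_eq_0: "x \<le> 0 \<Longrightarrow> max 0 (min 1 x) = (0::real)"
  by simp

lemma quantile_bounds: "l < N \<Longrightarrow> 0 < quantile N l \<and> quantile N l < 1"
  by (auto simp: quantile_def field_simps)

context
  fixes k N :: nat and \<mu> :: "nat \<Rightarrow> real"
  assumes k: "k \<ge> 1" and nonneg: "\<And>j. \<mu> j \<ge> 0" and total: "(\<Sum>j<k. \<mu> j) = 1"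
begin

text \<open>The last summand is 0, since every quantile lies below the total mass 1. The unit gained
  below \<open>k\<close> leaves room for the later drift along the curve.\<close>

lemma quantile_position_le:
  assumes "l < N"
  shows "quantile_position k N \<mu> l \<le> real k - 1"
proof -
  obtain k' where k': "k = Suc k'" using k by (cases k) auto
  have "quantile N l - (\<Sum>i\<le>k'. \<mu> i) < 0"
    using quantile_bounds[OF assms] total k' by (simp add: lessThan_Suc_atMost)
  then have "(quantile N l - (\<Sum>i\<le>k'. \<mu> i)) * (4 * real N) \<le> 0"
    by (intro mult_nonpos_nonneg) auto
  from clamp_eq_0[OF this]
  have "quantile_position k N \<mu> l = (\<Sum>j<k'. max 0 (min 1 ((quantile N l - (\<Sum>i\<le>j. \<mu> i)) * (4 * real N))))"
    unfolding quantile_position_def k' sum.lessThan_Suc by simp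
  also have "\<dots> \<le> (\<Sum>j<k'. 1)" by (intro sum_mono) auto
  finally show ?thesis by (simp add: k')
qed

text \<open>If no jump lies just below the quantile, every clamped summand is 0 or 1, and the sum
  counts the jumps below it. This count is the index of the first atom at which the distribution
  function reaches the quantile.\<close>

lemma quantile_position_at_atom:
  assumes l: "l < N"
    and settled: "\<And>j. j < k \<Longrightarrow> (\<Sum>i\<le>j. \<mu> i) < quantile N l \<Longrightarrow> (\<Sum>i\<le>j. \<mu> i) + 1 / (4 * real N) \<le> quantile N l"
  shows "\<exists>j<k. \<mu> j > 0 \<and> quantile_position k N \<mu> l = real j"
proof -
  define \<Lambda> where "\<Lambda> = (\<lambda>j. \<Sum>i\<le>j. \<mu> i)"
  have N: "N > 0" using l by simp
  have "\<Lambda> (k - 1) = 1" using total k by (metis \<Lambda>_def lessThan_Suc_atMost Suc_diff_1 less_le_trans zero_less_one)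
  then have ex: "quantile N l \<le> \<Lambda> (k - 1)" using quantile_bounds[OF l] by simp
  define J where "J = (LEAST j. quantile N l \<le> \<Lambda> j)"
  have J: "quantile N l \<le> \<Lambda> J" unfolding J_def by (rule LeastI, rule ex)
  have "J \<le> k - 1" unfolding J_def by (rule Least_le, rule ex)
  then have Jk: "J < k" using k by linarith
  have below: "\<Lambda> j < quantile N l" if "j < J" for j
    using not_less_Least[of j "\<lambda>j. quantile N l \<le> \<Lambda> j"] that by (simp add: J_def)
  have mono: "\<Lambda> i \<le> \<Lambda> j" if "i \<le> j" for i j
    unfolding \<Lambda>_def using that by (intro sum_mono2) (auto simp: nonneg)
  have "quantile_position k N \<mu> l = (\<Sum>j<k. if j < J then 1 else 0)"
    unfolding quantile_position_def
  proof (rule sum.cong)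
    fix j assume "j \<in> {..<k}"
    show "max 0 (min 1 ((quantile N l - (\<Sum>i\<le>j. \<mu> i)) * (4 * real N))) = (if j < J then 1 else 0)"
    proof (cases "j < J")
      case True
      then have "1 / (4 * real N) \<le> quantile N l - \<Lambda> j"
        using settled[of j] below[of j] \<open>j \<in> {..<k}\<close> by (simp add: \<Lambda>_def)
      then have "1 \<le> (quantile N l - \<Lambda> j) * (4 * real N)" using N by (simp add: field_simps)
      then show ?thesis using True by (simp add: \<Lambda>_def)
    next
      case False
      then have "quantile N l - \<Lambda> j \<le> 0" using J mono[of J j] by simp
      then have "(quantile N l - \<Lambda> j) * (4 * real N) \<le> 0" by (rule mult_nonpos_nonneg) simp
      from clamp_eq_0[OF this] show ?thesis using False by (simp add: \<Lambda>_def)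
    qed
  qed simp
  also have "\<dots> = (\<Sum>j<J. 1)" using Jk by (intro sum.mono_neutral_cong_right) auto
  finally have "quantile_position k N \<mu> l = real J" by simp
  moreover have "\<mu> J > 0"
  proof (cases J)
    case 0
    then show ?thesis using J quantile_bounds[OF l] by (simp add: \<Lambda>_def)
  next
    case (Suc i)
    then have "\<Lambda> J = \<Lambda> i + \<mu> J" by (simp add: \<Lambda>_def)
    then show ?thesis using J below[of i] Suc by simp
  qed
  ultimately show ?thesis using Jk by blast
qed

text \<open>A point moves only if its quantile lies in a window of length \<open>1 / (4 * N)\<close>
  above a jump. Quantiles are \<open>1 / N\<close> apart, so each window holds at most one, and
  moving points inject into the atoms.\<close>

lemma quantile_positions_mostly_at_atoms:
  "\<exists>T. card T \<le> card {j. j < k \<and> \<mu> j > 0} \<and> T \<subseteq> {..<N} \<and>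
     (\<forall>l\<in>{..<N} - T. \<exists>j<k. \<mu> j > 0 \<and> quantile_position k N \<mu> l = real j)"
proof -
  define \<Lambda> where "\<Lambda> = (\<lambda>j. \<Sum>i\<le>j. \<mu> i)"
  define moving where "moving = (\<lambda>l j. \<Lambda> j < quantile N l \<and> quantile N l < \<Lambda> j + 1 / (4 * real N))"
  define T where "T = {l. l < N \<and> (\<exists>j<k. moving l j)}"
  have jump: "\<exists>j<k. moving l j \<and> \<mu> j > 0" if "l \<in> T" for l
  proof -
    from that have l: "l < N" and ex: "\<exists>j. j < k \<and> moving l j" by (auto simp: T_def)
    \<comment> \<open>Minimality makes the atom carry mass: a massless \<open>j > 0\<close> has the
      same window as \<open>j - 1\<close>, and a massless \<open>j = 0\<close> has a window that
      ends below the first quantile \<open>1 / (2 * N)\<close>.\<close>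
    define j where "j = (LEAST j. j < k \<and> moving l j)"
    have j: "j < k" "moving l j" using LeastI_ex[OF ex] by (auto simp: j_def)
    have least: "\<not> moving l i" if "i < j" for i
      using not_less_Least[of i "\<lambda>j. j < k \<and> moving l j"] that j by (auto simp: j_def)
    have "\<mu> j \<noteq> 0"
    proof
      assume 0: "\<mu> j = 0"
      show False
      proof (cases j)
        case 0
        then have "quantile N l < 1 / (4 * real N)" using j(2) \<open>\<mu> j = 0\<close> by (simp add: moving_def \<Lambda>_def)
        moreover have "quantile N l \<ge> 1 / 2 / real N" unfolding quantile_def by (intro divide_right_mono) auto
        moreover have "1 / (4 * real N) < 1 / 2 / real N" using l by (simp add: field_simps)
        ultimately show False by linarith
      next
        case (Suc i)
        then have "moving l i" using j(2) 0 by (simp add: moving_def \<Lambda>_def)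
        then show False using least[of i] Suc by simp
      qed
    qed
    then show ?thesis using j nonneg[of j] by (metis less_le)
  qed
  define g where "g = (\<lambda>l. SOME j. j < k \<and> moving l j \<and> \<mu> j > 0)"
  have g: "g l < k" "moving l (g l)" "\<mu> (g l) > 0" if "l \<in> T" for l
    using someI_ex[of "\<lambda>j. j < k \<and> moving l j \<and> \<mu> j > 0"] jump[OF that] by (auto simp: g_def)
  have "inj_on g T"
  proof (rule inj_onI)
    fix l l' assume l: "l \<in> T" "l' \<in> T" and eq: "g l = g l'"
    have N: "N > 0" using l by (auto simp: T_def)
    have "\<bar>quantile N l - quantile N l'\<bar> < 1 / (4 * real N)"
      using g(2)[OF l(1)] g(2)[OF l(2)] eq by (auto simp: moving_def)
    moreover have "quantile N l - quantile N l' = (real l - real l') / real N"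
      by (simp add: quantile_def diff_divide_distrib add_divide_distrib)
    ultimately have "\<bar>real l - real l'\<bar> / real N < 1 / 4 / real N" using N by (simp add: mult.commute)
    then have "\<bar>real l - real l'\<bar> < 1 / 4" using N unfolding divide_less_cancel by simp
    then show "l = l'" by linarith
  qed
  then have "card T \<le> card {j. j < k \<and> \<mu> j > 0}"
    by (rule card_inj_on_le) (use g in auto)
  moreover have "\<exists>j<k. \<mu> j > 0 \<and> quantile_position k N \<mu> l = real j" if "l \<in> {..<N} - T" for l
  proof (rule quantile_position_at_atom)
    fix j assume "j < k" "(\<Sum>i\<le>j. \<mu> i) < quantile N l"
    moreover have "\<not> moving l j" using that \<open>j < k\<close> by (auto simp: T_def)
    ultimately show "(\<Sum>i\<le>j. \<mu> i) + 1 / (4 * real N) \<le> quantile N l"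
      by (simp add: moving_def \<Lambda>_def)
  qed (use that in auto)
  moreover have "T \<subseteq> {..<N}" by (auto simp: T_def)
  ultimately show ?thesis by blast
qed

end

subsection \<open>A dense injective curve on the sphere\<close>

text \<open>The net must lie in the open disc, as the angular coordinate on the sphere degenerates
  over the rim. Points of the closed disc are first shrunk slightly.\<close>

lemma finite_net_of_disc:
  fixes P :: "(real ^ 'n) set"
  assumes P: "subspace P" and \<delta>: "\<delta> > 0"
  shows "\<exists>Y. finite Y \<and> Y \<noteq> {} \<and> Y \<subseteq> P \<inter> ball 0 1 \<and> (\<forall>y \<in> P \<inter> cball 0 1. \<exists>y'\<in>Y. dist y y' < \<delta>)"
proof -
  have comp: "compact (P \<inter> cball 0 1)"
    using closed_subspace[OF P] by (intro closed_Int_compact compact_cball)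
  have cover: "P \<inter> cball 0 1 \<subseteq> (\<Union>y\<in>P \<inter> ball 0 1. ball y \<delta>)"
  proof
    fix y assume y: "y \<in> P \<inter> cball 0 1"
    define r where "r = max 0 (1 - \<delta> / 2)"
    have r: "0 \<le> r" "r < 1" "1 - r < \<delta>" using \<delta> by (auto simp: r_def)
    have "r * norm y < 1" using r y mult_le_one[of r "norm y"] by (cases "norm y = 1") (auto simp: mult_le_one intro: le_less_trans[OF mult_right_le_one_le])
    then have "r *\<^sub>R y \<in> P \<inter> ball 0 1" using y r P by (auto simp: subspace_scale)
    moreover have "dist (r *\<^sub>R y) y < \<delta>"
    proof -
      have "dist (r *\<^sub>R y) y = norm ((r - 1) *\<^sub>R y)" by (simp add: dist_norm scaleR_diff_left)
      also have "\<dots> = (1 - r) * norm y" using r by simp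
      also have "\<dots> \<le> 1 - r" using y r by (simp add: mult_left_le)
      finally show ?thesis using r by simp
    qed
    ultimately show "y \<in> (\<Union>y\<in>P \<inter> ball 0 1. ball y \<delta>)" by force
  qed
  obtain Y where Y: "Y \<subseteq> P \<inter> ball 0 1" "finite Y" "P \<inter> cball 0 1 \<subseteq> (\<Union>y\<in>Y. ball y \<delta>)"
    by (rule compactE_image[OF comp _ cover]) auto
  have "0 \<in> P \<inter> cball 0 1" using P by (simp add: subspace_0)
  then have "Y \<noteq> {}" using Y(3) by blast
  then show ?thesis using Y by (intro exI[of _ Y]) (force simp: dist_commute)
qed

text \<open>The angle in the plane of two coordinates increases along the curve, which makes it injective, while
  the remaining coordinates run through a fine net of the complementary disc during every small angular step.\<close>
lemma dense_injective_curve_on_sphere: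
  assumes n: "CARD('n::finite) \<ge> 2" and \<epsilon>: "\<epsilon> > 0"
  obtains k :: nat and \<gamma> :: "real \<Rightarrow> real ^ 'n"
  where "k \<ge> 1" "continuous_on UNIV \<gamma>" "\<And>s. norm (\<gamma> s) = 1" "inj_on \<gamma> {0..real k}"
    "\<And>x. norm x = 1 \<Longrightarrow> \<exists>j<k. dist x (\<gamma> (real j)) < \<epsilon>"
proof -
  obtain a b :: 'n where ab: "a \<noteq> b"
    using n card_le_Suc0_iff_eq[of "UNIV :: 'n set"] by fastforce
  define P where "P = {y :: real ^ 'n. y $ a = 0 \<and> y $ b = 0}"
  have P: "subspace P" by (auto simp: P_def subspace_def)
  have ax [simp]: "axis a (1::real) $ a = 1" "axis b (1::real) $ b = 1" "axis a (1::real) $ b = 0" "axis b (1::real) $ a = 0"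
    using ab by (auto simp: axis_def)
  define u where "u = (\<lambda>\<omega>. cos \<omega> *\<^sub>R axis a 1 + sin \<omega> *\<^sub>R axis b 1 :: real ^ 'n)"
  \<comment> \<open>Coordinates on the sphere: \<open>y\<close> in the disc complementary to the
    plane of \<open>a\<close> and \<open>b\<close>, and the angle \<open>\<omega>\<close> in that
    plane. They are injective where \<open>norm y < 1\<close>.\<close>
  define \<Gamma> where "\<Gamma> = (\<lambda>(y :: real ^ 'n, \<omega>). sqrt (1 - y \<bullet> y) *\<^sub>R u \<omega> + y)"
  have \<Gamma>_cont: "continuous_on A \<Gamma>" for A
    unfolding \<Gamma>_def u_def case_prod_unfold by (intro continuous_intros)
  have u_ab: "u \<omega> $ a = cos \<omega>" "u \<omega> $ b = sin \<omega>" "i \<noteq> a \<Longrightarrow> i \<noteq> b \<Longrightarrow> u \<omega> $ i = 0" for \<omega> i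
    using ab by (auto simp: u_def axis_def)
  have u_inner: "u \<omega> \<bullet> u \<omega> = 1" "y \<in> P \<Longrightarrow> u \<omega> \<bullet> y = 0" for \<omega> y
    using ab sin_cos_squared_add2[of \<omega>]
    by (auto simp: u_def P_def inner_add_left inner_add_right inner_axis inner_axis' power2_eq_square)
  have \<Gamma>_norm: "norm (\<Gamma> (y, \<omega>)) = 1" if "y \<in> P" "norm y \<le> 1" for y \<omega>
  proof -
    have "y \<bullet> y \<le> 1" using that power_le_one[of "norm y" 2] by (simp add: dot_square_norm)
    have "\<Gamma> (y, \<omega>) \<bullet> \<Gamma> (y, \<omega>) = (sqrt (1 - y \<bullet> y))\<^sup>2 * (u \<omega> \<bullet> u \<omega>) + 2 * sqrt (1 - y \<bullet> y) * (u \<omega> \<bullet> y) + y \<bullet> y"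
      by (simp add: \<Gamma>_def inner_add_left inner_add_right inner_commute power2_eq_square)
    also have "\<dots> = 1" using \<open>y \<bullet> y \<le> 1\<close> that by (simp add: u_inner)
    finally show ?thesis by (simp add: norm_eq_1)
  qed
  have \<Gamma>_surj: "\<exists>y \<omega>. x = \<Gamma> (y, \<omega>) \<and> y \<in> P \<inter> cball 0 1 \<and> 0 \<le> \<omega> \<and> \<omega> < 2 * pi" if x: "norm x = 1" for x
  proof -
    define y where "y = x - (x $ a) *\<^sub>R axis a 1 - (x $ b) *\<^sub>R axis b 1"
    define r where "r = sqrt ((x $ a)\<^sup>2 + (x $ b)\<^sup>2)"
    have y: "y \<in> P" using ab by (auto simp: y_def P_def axis_def)
    have "x \<bullet> x = 1" using x by (simp add: norm_eq_1)
    then have yy: "1 - y \<bullet> y = (x $ a)\<^sup>2 + (x $ b)\<^sup>2"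
      using ab by (simp add: y_def inner_diff_left inner_diff_right inner_axis inner_axis' power2_eq_square)
    then have "y \<bullet> y \<le> 1" by (smt (verit) zero_le_power2)
    then have "norm y \<le> 1" by (simp add: norm_le_square[where a = 1, simplified])
    have "\<exists>\<omega>. 0 \<le> \<omega> \<and> \<omega> < 2 * pi \<and> x $ a = r * cos \<omega> \<and> x $ b = r * sin \<omega>"
    proof (cases "r = 0")
      case True
      then have "x $ a = 0" "x $ b = 0" by (auto simp: r_def sum_power2_eq_zero_iff)
      then show ?thesis using True by (intro exI[of _ 0]) auto
    next
      case False
      have r2: "r\<^sup>2 = (x $ a)\<^sup>2 + (x $ b)\<^sup>2" by (simp add: r_def)
      have "(x $ a / r)\<^sup>2 + (x $ b / r)\<^sup>2 = 1"
        using False by (simp add: power_divide flip: add_divide_distrib r2)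
      then obtain \<omega> where "0 \<le> \<omega>" "\<omega> < 2 * pi" "x $ a / r = cos \<omega>" "x $ b / r = sin \<omega>"
        using sincos_total_2pi by metis
      then show ?thesis using False by (intro exI[of _ \<omega>]) (auto simp: field_simps)
    qed
    then obtain \<omega> where \<omega>: "0 \<le> \<omega>" "\<omega> < 2 * pi" "x $ a = r * cos \<omega>" "x $ b = r * sin \<omega>" by blast
    have "sqrt (1 - y \<bullet> y) = r" using yy by (simp add: r_def)
    then have "x = \<Gamma> (y, \<omega>)"
      using \<omega> by (simp add: \<Gamma>_def u_def y_def scaleR_add_right)
    then show ?thesis using y \<open>norm y \<le> 1\<close> \<omega> by (auto intro!: exI[of _ y] exI[of _ \<omega>])
  qed
  have \<Gamma>_inj: "y = y' \<and> \<omega> = \<omega>'"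
    if "\<Gamma> (y, \<omega>) = \<Gamma> (y', \<omega>')" "y \<in> P" "y' \<in> P" "norm y < 1" "0 \<le> \<omega>" "\<omega> < 2 * pi" "0 \<le> \<omega>'" "\<omega>' < 2 * pi"
    for y y' \<omega> \<omega>'
  proof -
    have comp: "\<Gamma> (y, \<omega>) $ i = \<Gamma> (y', \<omega>') $ i" for i using that(1) by simp
    have "y $ i = y' $ i" for i
      using comp[of i] that(2,3) u_ab(3)[of i] by (cases "i = a \<or> i = b") (auto simp: \<Gamma>_def P_def)
    then have y: "y = y'" by (simp add: vec_eq_iff)
    have "y \<bullet> y < 1" using that(4) by (simp add: dot_square_norm abs_square_less_1)
    then have "cos \<omega> = cos \<omega>'" "sin \<omega> = sin \<omega>'"
      using comp[of a] comp[of b] y by (auto simp: \<Gamma>_def u_ab)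
    then obtain m :: int where "\<omega> = \<omega>' + 2 * pi * m"
      using sin_cos_eq_iff[of \<omega> \<omega>'] by auto
    moreover from this have "m = 0"
    proof -
      have "\<omega>' + 2 * pi * m < 2 * pi" "0 \<le> \<omega>' + 2 * pi * m" using that \<open>\<omega> = \<omega>' + 2 * pi * m\<close> by blast+
      then have "2 * pi * m < 2 * pi * 1" "2 * pi * (-1) < 2 * pi * m" using that(7,8) by linarith+
      then have "real_of_int m < 1" "- 1 < real_of_int m" 
        using mult_less_cancel_left_pos[of "2 * pi"] pi_gt_zero by fastforce+
      then show ?thesis by linarith
    qed
    ultimately show ?thesis using y by simp
  qed
  have "uniformly_continuous_on ((P \<inter> cball 0 1) \<times> {0..2 * pi}) \<Gamma>"
    using closed_subspace[OF P] by (intro compact_uniformly_continuous \<Gamma>_cont compact_Times closed_Int_compact compact_cball compact_Icc)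
  then obtain \<delta> where \<delta>: "\<delta> > 0" and uc: "\<And>p q. p \<in> (P \<inter> cball 0 1) \<times> {0..2 * pi} \<Longrightarrow> q \<in> (P \<inter> cball 0 1) \<times> {0..2 * pi} \<Longrightarrow>
      dist q p < \<delta> \<Longrightarrow> dist (\<Gamma> q) (\<Gamma> p) < \<epsilon>"
    using \<epsilon> unfolding uniformly_continuous_on_def by metis
  obtain Y where Y: "finite Y" "Y \<noteq> {}" "Y \<subseteq> P \<inter> ball 0 1" "\<And>y. y \<in> P \<inter> cball 0 1 \<Longrightarrow> \<exists>y'\<in>Y. dist y y' < \<delta> / 2"
    using finite_net_of_disc[OF P, of "\<delta> / 2"] \<delta> by (metis half_gt_zero)
  define m where "m = card Y"
  have m: "m > 0" using Y by (simp add: m_def card_gt_0_iff)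
  obtain h where h: "bij_betw h {0..<m} Y" using ex_bij_betw_nat_finite[OF Y(1)] by (auto simp: m_def)
  \<comment> \<open>\<open>l\<close> is the number of runs through the net during one turn. The
    angular error below is at most \<open>4 * pi / l\<close>, which this choice makes less than
    \<open>\<delta> / 2\<close>.\<close>
  obtain l :: nat where l: "8 * pi / \<delta> < l" using reals_Archimedean2 by blast
  have l0: "l > 0" using l \<delta> by (smt (verit) divide_pos_pos of_nat_0_less_iff pi_gt_zero)
  define k where "k = l * m"
  have k: "k \<ge> 1" using l0 m by (simp add: k_def Suc_le_eq)
  have Y_h: "h (j mod m) \<in> Y" for j using h m by (auto simp: bij_betw_def)
  have D: "convex (P \<inter> ball 0 1)" "P \<inter> ball 0 1 \<noteq> {}" "closedin (top_of_set UNIV) (real ` {..<k})"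
    "continuous_on (real ` {..<k}) (\<lambda>s. h (nat \<lfloor>s\<rfloor> mod m))"
    "(\<lambda>s. h (nat \<lfloor>s\<rfloor> mod m)) ` real ` {..<k} \<subseteq> P \<inter> ball 0 1"
  proof -
    show "convex (P \<inter> ball 0 1)" using P by (intro convex_Int subspace_imp_convex convex_ball)
    show "P \<inter> ball 0 1 \<noteq> {}" using Y by blast
    show "closedin (top_of_set UNIV) (real ` {..<k})" by (simp add: finite_imp_closed)
    show "continuous_on (real ` {..<k}) (\<lambda>s. h (nat \<lfloor>s\<rfloor> mod m))" by (intro continuous_on_finite) simp
    show "(\<lambda>s. h (nat \<lfloor>s\<rfloor> mod m)) ` real ` {..<k} \<subseteq> P \<inter> ball 0 1"
      using Y(3) Y_h by blast
  qed
  \<comment> \<open>At the integers below \<open>k\<close> the curve visits the net points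
    cyclically; Dugundji's extension theorem fills in between them without leaving the convex open
    disc.\<close>
  obtain g :: "real \<Rightarrow> real ^ 'n" where g: "continuous_on UNIV g" "range g \<subseteq> P \<inter> ball 0 1"
      "\<And>s. s \<in> real ` {..<k} \<Longrightarrow> g s = h (nat \<lfloor>s\<rfloor> mod m)"
    using Dugundji[OF D] by blast
  have gP: "g s \<in> P" "norm (g s) < 1" for s using subsetD[OF g(2) rangeI[of g s]] by simp_all
  \<comment> \<open>The denominator \<open>k + 1\<close> keeps the angle below \<open>2 * pi\<close>
    on all of \<open>{0..real k}\<close>, so the curve does not close up.\<close>
  define \<theta> where "\<theta> = (\<lambda>s. 2 * pi * (s / (k + 1)))"
  define \<gamma> where "\<gamma> = (\<lambda>s. \<Gamma> (g s, \<theta> s))"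
  have \<theta>: "0 \<le> \<theta> s" "\<theta> s < 2 * pi" if "s \<in> {0..real k}" for s
  proof -
    have "s / (k + 1) < 1" "0 \<le> s / (k + 1)" using that by auto
    then show "0 \<le> \<theta> s" "\<theta> s < 2 * pi"
      using mult_strict_left_mono[of "s / (k + 1)" 1 "2 * pi"] mult_nonneg_nonneg[of "2 * pi" "s / (k + 1)"]
      unfolding \<theta>_def by (simp_all del: times_divide_eq_right)
  qed
  show thesis
  proof (rule that[of k \<gamma>])
    show "k \<ge> 1" by (rule k)
    show "continuous_on UNIV \<gamma>"
      unfolding \<gamma>_def \<theta>_def by (intro continuous_on_compose2[OF \<Gamma>_cont[of UNIV]] continuous_intros g(1)) auto
    show "norm (\<gamma> s) = 1" for s
      unfolding \<gamma>_def using gP[of s] by (intro \<Gamma>_norm) auto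
    show "inj_on \<gamma> {0..real k}"
    proof (rule inj_onI)
      fix s s' assume s: "s \<in> {0..real k}" "s' \<in> {0..real k}" and "\<gamma> s = \<gamma> s'"
      then have "\<theta> s = \<theta> s'"
        unfolding \<gamma>_def using \<Gamma>_inj[of "g s" "\<theta> s" "g s'" "\<theta> s'"] gP \<theta>[OF s(1)] \<theta>[OF s(2)] by auto
      then show "s = s'" by (simp add: \<theta>_def divide_simps)
    qed
    fix x :: "real ^ 'n" assume "norm x = 1"
    then obtain y \<omega> where x: "x = \<Gamma> (y, \<omega>)" and y: "y \<in> P \<inter> cball 0 1" and \<omega>: "0 \<le> \<omega>" "\<omega> < 2 * pi"
      using \<Gamma>_surj by blast
    obtain y' where y': "y' \<in> Y" "dist y y' < \<delta> / 2" using Y(4)[OF y] by blast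
    then obtain i where i: "i < m" "h i = y'" using h by (auto simp: bij_betw_def)
    define \<tau> where "\<tau> = \<omega> / (2 * pi) * (k + 1)"
    have "\<omega> / (2 * pi) < 1" "0 \<le> \<omega> / (2 * pi)" using \<omega> by (auto simp: divide_less_eq)
    then have \<tau>: "0 \<le> \<tau>" "\<tau> < k + 1"
      using mult_strict_right_mono[of "\<omega> / (2 * pi)" 1 "real k + 1"] mult_nonneg_nonneg[of "\<omega> / (2 * pi)" "real k + 1"]
      unfolding \<tau>_def by (simp_all del: times_divide_eq_left add: add.commute)
    \<comment> \<open>\<open>q\<close> is the run through the net in which the time
      \<open>\<tau>\<close> falls. The minimum treats \<open>\<tau>\<close> in the last unit, from
      \<open>k\<close> to \<open>k + 1\<close>, where no run is left.\<close>
    define q where "q = min (nat \<lfloor>\<tau> / m\<rfloor>) (l - 1)"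
    define j where "j = q * m + i"
    have "q \<le> l - 1" by (simp add: q_def)
    have "j < (q + 1) * m" using i by (simp add: j_def)
    also have "\<dots> \<le> k" unfolding k_def using \<open>q \<le> l - 1\<close> l0 by (intro mult_le_mono1) simp
    finally have jk: "j < k" .
    have fl: "real (nat \<lfloor>\<tau> / m\<rfloor>) \<le> \<tau> / m" "\<tau> / m < real (nat \<lfloor>\<tau> / m\<rfloor>) + 1"
      using \<tau> by (auto simp: of_nat_floor)
    have "\<bar>\<omega> - \<theta> j\<bar> < \<delta> / 2"
    proof -
      have "real j \<le> \<tau> + m"
      proof -
        have "real q \<le> \<tau> / m" using fl by (simp add: q_def)
        then have "real q * m \<le> \<tau>" using m by (simp add: field_simps)
        then show ?thesis using i by (simp add: j_def)
      qed
      moreover have "\<tau> \<le> real j + (m + 1)"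
      proof (cases "nat \<lfloor>\<tau> / m\<rfloor> \<le> l - 1")
        case True
        then have "\<tau> < (real q + 1) * m" using fl m by (simp add: q_def field_simps)
        then show ?thesis by (simp add: j_def algebra_simps)
      next
        case False
        then have "q + 1 = l" using l0 by (simp add: q_def)
        then have "q * m + m = k" by (metis add.commute k_def mult_Suc Suc_eq_plus1)
        then have "real q * m + m = k" by (metis of_nat_add of_nat_mult)
        then show ?thesis using \<tau> by (simp add: j_def)
      qed
      ultimately have "\<bar>\<tau> - j\<bar> \<le> m + 1" by simp
      moreover have "\<omega> - \<theta> j = 2 * pi / (k + 1) * (\<tau> - j)"
      proof -
        have "\<omega> = 2 * pi * (\<tau> / (k + 1))" by (simp add: \<tau>_def add_eq_0_iff_both_eq_0)
        then have "\<omega> - \<theta> j = 2 * pi * (\<tau> / (k + 1)) - 2 * pi * (j / (k + 1))" by (simp add: \<theta>_def)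
        also have "\<dots> = 2 * pi / (k + 1) * (\<tau> - j)" by (simp add: diff_divide_distrib right_diff_distrib)
        finally show ?thesis .
      qed
      ultimately have "\<bar>\<omega> - \<theta> j\<bar> \<le> 2 * pi / (k + 1) * (m + 1)"
        using mult_left_mono[of "\<bar>\<tau> - j\<bar>" "real m + 1" "2 * pi / (k + 1)"] by (simp add: abs_mult add.commute)
      also have "\<dots> \<le> 2 * pi / (l * m) * (2 * m)"
        using m l0 by (intro mult_mono divide_left_mono) (auto simp: k_def intro!: mult_pos_pos add_pos_nonneg)
      also have "\<dots> = 4 * pi / l" using m by simp
      also have "\<dots> < \<delta> / 2" using l l0 \<delta> by (simp add: field_simps)
      finally show ?thesis .
    qed
    moreover have gj: "g j = y'"
    proof -
      have "real j \<in> real ` {..<k}" using jk by simp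
      then have "g j = h (nat \<lfloor>real j\<rfloor> mod m)" by (rule g(3))
      also have "nat \<lfloor>real j\<rfloor> mod m = i" using i by (simp only: floor_of_nat nat_int) (simp add: j_def)
      finally show ?thesis using i by simp
    qed
    ultimately have "dist (y, \<omega>) (g j, \<theta> j) < \<delta>"
      using y' sqrt_sum_squares_le_sum_abs[of "dist y y'" "dist \<omega> (\<theta> j)"] by (simp add: dist_Pair_Pair dist_real_def)
    then have "dist (\<Gamma> (y, \<omega>)) (\<Gamma> (g j, \<theta> j)) < \<epsilon>"
      using y \<omega> gP[of "real j"] \<theta>[of "real j"] jk by (intro uc) auto
    then show "\<exists>j<k. dist x (\<gamma> (real j)) < \<epsilon>"
      using jk x by (auto simp: \<gamma>_def)
  qed
qed

subsection \<open>Equal weight points\<close>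

text \<open>Kane's argument: the points are the quantiles of a measure on the curve which is carried by few
  places where the function with coefficients \<open>v\<close> is almost maximal.  So all but \<open>m + 1\<close> of the
  \<open>N\<close> points nearly attain the maximum, and the others cost at most \<open>K\<close> times as much.\<close>
theorem equal_weight_points_on_sphere:
  fixes \<phi> :: "nat \<Rightarrow> real ^ 'n \<Rightarrow> real" and K :: real
  assumes n: "CARD('n) \<ge> 2"
    and cont: "\<And>i. i < m \<Longrightarrow> continuous_on (sphere 0 1) (\<phi> i)"
    and bound: "\<And>v b x. b \<ge> 0 \<Longrightarrow> (\<And>x. norm x = 1 \<Longrightarrow> (\<Sum>i<m. v i * \<phi> i x) \<le> b) \<Longrightarrow> norm x = 1 \<Longrightarrow>
      (\<Sum>i<m. v i * \<phi> i x) \<ge> - (K * b)"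
    and indep: "\<And>v. (\<And>x. norm x = 1 \<Longrightarrow> (\<Sum>i<m. v i * \<phi> i x) = 0) \<Longrightarrow> \<forall>i<m. v i = 0"
    and K: "K \<ge> 0" and N: "real N \<ge> (real m + 1) * (K + 1) + 1"
  shows "\<exists>X. finite X \<and> card X = N \<and> X \<subseteq> sphere 0 1 \<and> (\<forall>i<m. (\<Sum>x\<in>X. \<phi> i x) = 0)"
proof -
  define val where "val = (\<lambda>(v::nat \<Rightarrow> real) x. \<Sum>i<m. v i * \<phi> i x)"
  have N1: "real N \<ge> 1" using N K by (smt (verit) mult_nonneg_nonneg of_nat_0_le_iff)
  define U where "U = {v::nat \<Rightarrow> real. (\<Sum>i<m. (v i)\<^sup>2) = 1 \<and> (\<forall>i\<ge>m. v i = 0)}"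
  have cU: "compact U"
  proof -
    have cP: "compact (PiE UNIV (\<lambda>_. {-1..1}) :: (nat \<Rightarrow> real) set)"
      using compactin_PiE[of "\<lambda>_::nat. euclideanreal" UNIV "\<lambda>_. {-1..1}"]
      by (simp add: euclidean_product_topology)
    have eq: "U = PiE UNIV (\<lambda>_. {-1..1}) \<inter> U"
    proof -
      have "\<bar>v i\<bar> \<le> 1" if "v \<in> U" for v i
        using that member_le_sum[of i "{..<m}" "\<lambda>i. (v i)\<^sup>2"]
        by (cases "i < m") (auto simp: U_def abs_square_le_1)
      then show ?thesis by (auto simp: abs_le_iff minus_le_iff)
    qed
    have "closed ((\<Inter>i\<in>{m..}. {v. v i = 0}) \<inter> {v::nat \<Rightarrow> real. (\<Sum>i<m. (v i)\<^sup>2) = 1})"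
      by (intro closed_Int closed_INT ballI closed_Collect_eq continuous_on_sum continuous_on_power
          continuous_on_product_coordinates continuous_on_const)
    also have "\<dots> = U" by (auto simp: U_def)
    finally have cl: "closed U" .
    show ?thesis by (subst eq) (rule compact_Int_closed[OF cP cl])
  qed
  have op: "open {v. val v (fst z) > snd z}" for z
    unfolding val_def
    by (intro open_Collect_less continuous_on_sum continuous_on_mult continuous_on_product_coordinates continuous_on_const)
  \<comment> \<open>The hypothesis \<open>bound\<close> with \<open>b = 0\<close> makes a
    combination that is nowhere positive vanish on the sphere, against independence. So every unit
    \<open>v\<close> is positive somewhere.\<close>
  have cov: "U \<subseteq> (\<Union>z\<in>{z. norm (fst z) = 1 \<and> snd z > 0}. {v. val v (fst z) > snd z})"
  proof
    fix v assume v: "v \<in> U"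
    have "\<exists>x. norm x = 1 \<and> val v x > 0"
    proof (rule ccontr)
      assume "\<not> ?thesis"
      then have le: "val v x \<le> 0" if "norm x = 1" for x using that by (meson not_less)
      have "val v x \<ge> - (K * 0)" if "norm x = 1" for x
        unfolding val_def by (rule bound) (use le that in \<open>auto simp: val_def\<close>)
      with le have "val v x = 0" if "norm x = 1" for x using that by (intro antisym) auto
      then have "\<forall>i<m. v i = 0" using indep[of v] by (simp add: val_def)
      then show False using v by (simp add: U_def)
    qed
    then obtain x where "norm x = 1" "val v x > 0" by blast
    then show "v \<in> (\<Union>z\<in>{z. norm (fst z) = 1 \<and> snd z > 0}. {v. val v (fst z) > snd z})"
      by (intro UN_I[of "(x, val v x / 2)"]) auto
  qed
  obtain Z where Z: "Z \<subseteq> {z. norm (fst z) = 1 \<and> snd z > 0}" "finite Z" "U \<subseteq> (\<Union>z\<in>Z. {v. val v (fst z) > snd z})"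
    by (rule compactE_image[OF cU op cov])
  \<comment> \<open>A uniform lower bound for the maximum over unit \<open>v\<close>. The inserted 1
    keeps \<open>Min\<close> meaningful when \<open>m = 0\<close>, where \<open>U\<close> is
    empty.\<close>
  define \<kappa> where "\<kappa> = Min (insert 1 (snd ` Z))"
  have \<kappa>: "\<kappa> > 0" using Z by (auto simp: \<kappa>_def)
  have val_large: "\<exists>x. norm x = 1 \<and> val v x \<ge> \<kappa> * R"
    if R: "R > 0" and v: "(\<Sum>i<m. (v i)\<^sup>2) = R\<^sup>2" "\<And>i. i \<ge> m \<Longrightarrow> v i = 0" for v R
  proof -
    have "(\<lambda>i. v i / R) \<in> U"
      using v R by (simp add: U_def power_divide flip: sum_divide_distrib)
    then obtain z where z: "z \<in> Z" "val (\<lambda>i. v i / R) (fst z) > snd z" using Z(3) by blast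
    have "val (\<lambda>i. v i / R) (fst z) = val v (fst z) / R" by (simp add: val_def sum_divide_distrib)
    moreover have "\<kappa> \<le> snd z" using z(1) Z(2) by (auto simp: \<kappa>_def intro!: Min_le)
    ultimately have "\<kappa> \<le> val v (fst z) / R" using z(2) by linarith
    then have "\<kappa> * R \<le> val v (fst z)" using R by (simp add: pos_le_divide_eq)
    then show ?thesis using Z(1) z(1) by blast
  qed
  define \<epsilon> where "\<epsilon> = \<kappa> / (8 * real N) / (real m + 1)"
  have \<epsilon>: "\<epsilon> > 0" using \<kappa> N1 by (simp add: \<epsilon>_def add_nonneg_pos)
  have m1: "real m + 1 \<noteq> 0" by linarith
  have \<epsilon>m: "\<epsilon> * (real m + 1) = \<kappa> / (8 * real N)"
    unfolding \<epsilon>_def using m1 by (metis nonzero_divide_eq_eq)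
  have "\<exists>\<delta>>0. \<forall>i<m. \<forall>x y. norm x = 1 \<longrightarrow> norm y = 1 \<longrightarrow> dist x y < \<delta> \<longrightarrow> \<bar>\<phi> i x - \<phi> i y\<bar> < \<epsilon>"
  proof -
    have "\<exists>\<delta>>0. \<forall>x y. norm x = 1 \<longrightarrow> norm y = 1 \<longrightarrow> dist x y < \<delta> \<longrightarrow> \<bar>\<phi> i x - \<phi> i y\<bar> < \<epsilon>" if "i < m" for i
      using compact_uniformly_continuous[OF cont[OF that] compact_sphere] \<epsilon>
      unfolding uniformly_continuous_on_def by (force simp: dist_real_def dist_commute)
    then obtain d where d: "\<And>i. i < m \<Longrightarrow> d i > 0"
      "\<And>i x y. i < m \<Longrightarrow> norm x = 1 \<Longrightarrow> norm y = 1 \<Longrightarrow> dist x y < d i \<Longrightarrow> \<bar>\<phi> i x - \<phi> i y\<bar> < \<epsilon>"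
      by metis
    have "Min (insert 1 (d ` {..<m})) > 0" using d(1) by auto
    moreover have "Min (insert 1 (d ` {..<m})) \<le> d i" if "i < m" for i using that by (auto intro!: Min_le)
    ultimately show ?thesis using d(2) by (intro exI[of _ "Min (insert 1 (d ` {..<m}))"]) (meson less_le_trans)
  qed
  then obtain \<delta>1 where \<delta>1: "\<delta>1 > 0"
    "\<And>i x y. i < m \<Longrightarrow> norm x = 1 \<Longrightarrow> norm y = 1 \<Longrightarrow> dist x y < \<delta>1 \<Longrightarrow> \<bar>\<phi> i x - \<phi> i y\<bar> < \<epsilon>"
    by blast
  have osc: "\<bar>val v x - val v y\<bar> \<le> \<kappa> * R / (8 * real N)"
    if "R > 0" "(\<Sum>i<m. (v i)\<^sup>2) = R\<^sup>2" "norm x = 1" "norm y = 1" "dist x y < \<delta>1" for v R x y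
  proof -
    have "\<bar>v i\<bar> \<le> R" if "i < m" for i
    proof -
      have "(v i)\<^sup>2 \<le> R\<^sup>2"
        using member_le_sum[of i "{..<m}" "\<lambda>i. (v i)\<^sup>2"] that \<open>(\<Sum>i<m. (v i)\<^sup>2) = R\<^sup>2\<close> by simp
      then show ?thesis using \<open>R > 0\<close> abs_le_square_iff[of "v i" R] by simp
    qed
    then have "\<bar>v i * (\<phi> i x - \<phi> i y)\<bar> \<le> R * \<epsilon>" if "i < m" for i
      unfolding abs_mult using \<delta>1(2)[of i x y] that \<open>norm x = 1\<close> \<open>norm y = 1\<close> \<open>dist x y < \<delta>1\<close> \<open>R > 0\<close>
      by (intro mult_mono) (auto intro: less_imp_le)
    then have "(\<Sum>i<m. \<bar>v i * (\<phi> i x - \<phi> i y)\<bar>) \<le> (\<Sum>i<m. R * \<epsilon>)" by (intro sum_mono) auto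
    moreover have "\<bar>val v x - val v y\<bar> \<le> (\<Sum>i<m. \<bar>v i * (\<phi> i x - \<phi> i y)\<bar>)"
      unfolding val_def sum_subtractf[symmetric] right_diff_distrib[symmetric] by (rule sum_abs)
    moreover have "(\<Sum>i<m. R * \<epsilon>) \<le> (real m + 1) * (R * \<epsilon>)"
      using \<epsilon> \<open>R > 0\<close> by (simp add: distrib_right)
    moreover have "(real m + 1) * (R * \<epsilon>) = \<kappa> * R / (8 * real N)"
    proof -
      have "(real m + 1) * (R * \<epsilon>) = (\<epsilon> * (real m + 1)) * R" by (simp only: mult_ac)
      then show ?thesis by (simp add: \<epsilon>m)
    qed
    ultimately show ?thesis by linarith
  qed
  obtain k :: nat and \<gamma> :: "real \<Rightarrow> real ^ 'n" where k: "k \<ge> 1" and \<gamma>_cont: "continuous_on UNIV \<gamma>"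
    and \<gamma>_norm: "\<And>s. norm (\<gamma> s) = 1" and \<gamma>_inj: "inj_on \<gamma> {0..real k}"
    and \<gamma>_dense: "\<And>x. norm x = 1 \<Longrightarrow> \<exists>j<k. dist x (\<gamma> (real j)) < \<delta>1"
    using dense_injective_curve_on_sphere[OF n \<delta>1(1)] by blast
  have "uniformly_continuous_on {0..real k} \<gamma>"
    by (intro compact_uniformly_continuous continuous_on_subset[OF \<gamma>_cont]) auto
  then obtain \<delta>2 where \<delta>2: "\<delta>2 > 0"
    "\<And>s s'. s \<in> {0..real k} \<Longrightarrow> s' \<in> {0..real k} \<Longrightarrow> dist s s' < \<delta>2 \<Longrightarrow> dist (\<gamma> s) (\<gamma> s') < \<delta>1"
    unfolding uniformly_continuous_on_def using \<delta>1(1) by (metis dist_commute)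
  \<comment> \<open>The bound 1 keeps drifted positions within \<open>{0..real k}\<close>; the bound
    \<open>\<delta>2\<close> makes the drift harmless for the values on the curve.\<close>
  define \<delta> where "\<delta> = min 1 \<delta>2"
  have \<delta>: "\<delta> > 0" "\<delta> \<le> 1" "\<delta> \<le> \<delta>2" using \<delta>2 by (auto simp: \<delta>_def)
  obtain \<mu> :: "(nat \<Rightarrow> real) \<Rightarrow> nat \<Rightarrow> real" and B :: real where
    \<mu>_cont: "\<And>j. continuous_on UNIV (\<lambda>v. \<mu> v j)" and \<mu>_nonneg: "\<And>v j. \<mu> v j \<ge> 0" and \<mu>_total: "\<And>v. (\<Sum>j<k. \<mu> v j) = 1"
    and \<mu>_sparse: "\<And>v. card {j. j < k \<and> \<mu> v j > 0} \<le> m + 1"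
    and \<mu>_max: "\<And>v j l. j < k \<Longrightarrow> \<mu> v j > 0 \<Longrightarrow> l < k \<Longrightarrow>
      (\<Sum>i<m. v i * \<phi> i (\<gamma> (real l))) \<le> (\<Sum>i<m. v i * \<phi> i (\<gamma> (real j))) + B"
    by (rule continuous_sparse_weights[OF k, of m "\<lambda>j i. \<phi> i (\<gamma> (real j))"]) (rule that)
  \<comment> \<open>The drift term makes positions strictly increasing in \<open>l\<close>; with
    injectivity of the curve this yields \<open>N\<close> distinct points.\<close>
  define pos where "pos = (\<lambda>v l. quantile_position k N (\<mu> v) l + \<delta> * quantile N l)"
  have pos_range: "pos v l \<in> {0..real k}" "quantile_position k N (\<mu> v) l \<in> {0..real k}" if "l < N" for v l
  proof -
    have "0 < quantile N l" "quantile N l < 1" using quantile_bounds[OF that] by auto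
    then have "0 \<le> \<delta> * quantile N l" "\<delta> * quantile N l \<le> 1" using \<delta> by (auto intro: mult_le_one)
    then show "pos v l \<in> {0..real k}" "quantile_position k N (\<mu> v) l \<in> {0..real k}"
      using quantile_position_nonneg[of k N "\<mu> v" l] quantile_position_le[OF k \<mu>_nonneg \<mu>_total that, of v]
      by (auto simp: pos_def)
  qed
  define F where "F = (\<lambda>v i. \<Sum>l<N. \<phi> i (\<gamma> (pos v l)))"
  \<comment> \<open>Chosen so that \<open>\<kappa> * R = 2 * N * \<bar>B\<bar> + \<kappa>\<close>:
    the error \<open>B\<close>, incurred \<open>N\<close> times, takes less than half of
    \<open>\<kappa> * R\<close>, and the oscillation errors take a quarter.\<close>
  define R where "R = 2 * real N * \<bar>B\<bar> / \<kappa> + 1"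
  have R: "R > 0" using \<kappa> by (simp add: R_def add_nonneg_pos)
  have "\<exists>v. \<forall>i<m. F v i = 0"
  proof (rule outward_pointing_map_has_zero[OF _ R])
    fix i assume i: "i < m"
    have pos_cont: "continuous_on UNIV (\<lambda>v. pos v l)" for l
      unfolding pos_def by (intro continuous_intros continuous_on_quantile_position \<mu>_cont)
    show "continuous_on UNIV (\<lambda>v. F v i)"
      unfolding F_def
      by (intro continuous_on_sum continuous_on_compose2[OF cont[OF i]] continuous_on_compose2[OF \<gamma>_cont] pos_cont)
        (auto simp: \<gamma>_norm)
  next
    fix v :: "nat \<Rightarrow> real" assume v: "(\<Sum>i<m. (v i)\<^sup>2) = R\<^sup>2" "\<And>i. i \<ge> m \<Longrightarrow> v i = 0"
    define e where "e = \<kappa> * R / (8 * real N)"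
    note osc_e = osc[OF R v(1), folded e_def]
    have "\<exists>y\<in>sphere 0 1. \<forall>x\<in>sphere 0 1. val v x \<le> val v y"
    proof (rule continuous_attains_sup)
      obtain x :: "real ^ 'n" where "norm x = 1" using vector_choose_size[of 1] by auto
      then show "sphere (0 :: real ^ 'n) 1 \<noteq> {}" by force
      show "continuous_on (sphere 0 1) (val v)"
        unfolding val_def by (intro continuous_intros cont) auto
    qed (rule compact_sphere)
    then obtain y where y: "norm y = 1" "\<And>x. norm x = 1 \<Longrightarrow> val v x \<le> val v y" by auto
    define A where "A = val v y"
    have A: "A \<ge> \<kappa> * R" using val_large[OF R v] y(2) by (force simp: A_def)
    then have A0: "A \<ge> 0" using \<kappa> R by (meson less_le_trans mult_pos_pos less_imp_le)
    have low: "val v x \<ge> - (K * A)" if "norm x = 1" for x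
      unfolding val_def using y(2) by (intro bound[OF A0 _ that]) (auto simp: A_def val_def)
    obtain j0 where j0: "j0 < k" "dist y (\<gamma> (real j0)) < \<delta>1" using \<gamma>_dense[OF y(1)] by blast
    obtain T where T: "card T \<le> card {j. j < k \<and> \<mu> v j > 0}" "T \<subseteq> {..<N}"
      "\<And>l. l \<in> {..<N} - T \<Longrightarrow> \<exists>j<k. \<mu> v j > 0 \<and> quantile_position k N (\<mu> v) l = real j"
      using quantile_positions_mostly_at_atoms[OF k \<mu>_nonneg[of v] \<mu>_total[of v], of N] by blast
    have high: "val v (\<gamma> (pos v l)) \<ge> A - 2 * e - \<bar>B\<bar>" if l: "l \<in> {..<N} - T" for l
    proof -
      obtain j where j: "j < k" "\<mu> v j > 0" "quantile_position k N (\<mu> v) l = real j" using T(3)[OF l] by blast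
      have "dist (pos v l) (real j) < \<delta>2"
      proof -
        have "0 < quantile N l" "quantile N l < 1" using quantile_bounds[of l N] l by auto
        then have "0 \<le> \<delta> * quantile N l" "\<delta> * quantile N l < \<delta> * 1"
          using \<delta> by (auto simp del: mult_1_right intro!: mult_strict_left_mono)
        then show ?thesis unfolding pos_def dist_real_def j(3) using \<delta> by linarith
      qed
      then have "dist (\<gamma> (pos v l)) (\<gamma> (real j)) < \<delta>1"
        using pos_range(1)[of l v] l j(1) by (intro \<delta>2(2)) auto
      then have "\<bar>val v (\<gamma> (pos v l)) - val v (\<gamma> (real j))\<bar> \<le> e"
        by (intro osc_e \<gamma>_norm)
      moreover have "\<bar>val v y - val v (\<gamma> (real j0))\<bar> \<le> e"
        by (intro osc_e \<gamma>_norm y j0)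
      moreover have "val v (\<gamma> (real j0)) \<le> val v (\<gamma> (real j)) + B"
        using \<mu>_max[OF j(1,2) j0(1)] by (simp add: val_def)
      ultimately show ?thesis unfolding A_def by linarith
    qed
    have "(\<Sum>i<m. v i * F v i) = (\<Sum>l<N. val v (\<gamma> (pos v l)))"
      by (simp add: F_def val_def sum_distrib_left) (rule sum.swap)
    also have "\<dots> = (\<Sum>l\<in>T. val v (\<gamma> (pos v l))) + (\<Sum>l\<in>{..<N} - T. val v (\<gamma> (pos v l)))"
      using sum.subset_diff[OF T(2), of "\<lambda>l. val v (\<gamma> (pos v l))"] by simp
    also have "\<dots> \<ge> (\<Sum>l\<in>T. - (K * A)) + (\<Sum>l\<in>{..<N} - T. A - 2 * e - \<bar>B\<bar>)"
      using low high \<gamma>_norm by (intro add_mono sum_mono) auto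
    finally have sum_ge: "(\<Sum>i<m. v i * F v i) \<ge> - (real (card T) * (K * A)) + (real N - real (card T)) * (A - 2 * e - \<bar>B\<bar>)"
      using T(2) by (simp add: card_Diff_subset finite_subset of_nat_diff subset_eq_atLeast0_lessThan_card lessThan_atLeast0)
    have cT: "real (card T) \<le> real m + 1" using T(1) \<mu>_sparse[of v] by linarith
    \<comment> \<open>The final \<open>+ 1\<close> in the bound on \<open>N\<close> leaves a surplus
      of one full \<open>A \<ge> \<kappa> * R\<close> after the exceptional points are paid for, and
      this exceeds all errors.\<close>
    have "real (card T) * (K + 1) \<le> (real m + 1) * (K + 1)" using cT K by (intro mult_right_mono) auto
    then have "A * 1 \<le> A * (real N - real (card T) * (K + 1))" using A0 N by (intro mult_left_mono) auto
    moreover have "(real N - real (card T)) * (2 * e + \<bar>B\<bar>) \<le> real N * (2 * e + \<bar>B\<bar>)"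
      using \<kappa> R by (intro mult_right_mono) (auto simp: e_def)
    moreover have "real N * (2 * e + \<bar>B\<bar>) < \<kappa> * R"
    proof -
      have "real N * (2 * e) = \<kappa> * R / 4" using N1 by (simp add: e_def)
      moreover have "\<kappa> * R = 2 * (real N * \<bar>B\<bar>) + \<kappa>" using \<kappa> by (simp add: R_def field_simps)
      moreover have "0 \<le> real N * \<bar>B\<bar>" by simp
      ultimately show ?thesis using \<kappa> unfolding distrib_left by linarith
    qed
    moreover have "- (real (card T) * (K * A)) + (real N - real (card T)) * (A - 2 * e - \<bar>B\<bar>)
        = A * (real N - real (card T) * (K + 1)) - (real N - real (card T)) * (2 * e + \<bar>B\<bar>)"
      by (simp add: algebra_simps)
    ultimately show "(\<Sum>i<m. v i * F v i) > 0" using sum_ge A by linarith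
  qed
  then obtain v where v: "\<And>i. i < m \<Longrightarrow> F v i = 0" by blast
  have inj: "inj_on (\<lambda>l. \<gamma> (pos v l)) {..<N}"
  proof (rule linorder_inj_onI')
    fix l l' assume l: "l \<in> {..<N}" "l' \<in> {..<N}" "l < l'"
    have "quantile N l < quantile N l'" using l by (simp add: quantile_def divide_strict_right_mono)
    then have "pos v l < pos v l'"
      using quantile_position_mono[of l l' k N "\<mu> v"] l \<delta> by (simp add: pos_def add_le_less_mono)
    then show "\<gamma> (pos v l) \<noteq> \<gamma> (pos v l')"
      using inj_onD[OF \<gamma>_inj _ pos_range(1) pos_range(1), of v l v l'] l by auto
  qed
  show ?thesis
  proof (intro exI[of _ "(\<lambda>l. \<gamma> (pos v l)) ` {..<N}"] conjI allI impI)
    show "card ((\<lambda>l. \<gamma> (pos v l)) ` {..<N}) = N" using inj by (simp add: card_image)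
    show "(\<Sum>x\<in>(\<lambda>l. \<gamma> (pos v l)) ` {..<N}. \<phi> i x) = 0" if "i < m" for i
      using v[OF that] by (simp add: sum.reindex[OF inj] F_def o_def)
  qed (auto simp: \<gamma>_norm)
qed

subsection \<open>Designs of harmonic index\<close>

lemma Harm_eq_0_if_sphere_0:
  fixes f :: "real ^ 'n \<Rightarrow> real"
  assumes f: "f \<in> Harm t" and t: "t \<ge> 1" and zero: "\<And>x. norm x = 1 \<Longrightarrow> f x = 0"
  shows "f x = 0"
proof -
  have scale: "f (r *\<^sub>R y) = r ^ t * f y" for r y
    using f homogeneous_polynomial_scale by (auto simp: Harm_def)
  show ?thesis
  proof (cases "x = 0")
    case True
    then show ?thesis using scale[of 0 x] t by (simp add: power_0_left)
  next
    case False
    then have "f (x /\<^sub>R norm x) = 0" by (intro zero) simp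
    then show ?thesis using scale[of "norm x" "x /\<^sub>R norm x"] False by simp
  qed
qed

text \<open>An independent family of maximal length, which exists because
  \<open>Harm_dependent\<close> bounds the length. If adjoining \<open>f\<close> destroys
  independence, the coefficient of \<open>f\<close> in the resulting relation is nonzero and can be
  divided out.\<close>

lemma Harm_basis:
  assumes n: "CARD('n::finite) \<ge> 2"
  obtains m and \<phi> :: "nat \<Rightarrow> real ^ 'n \<Rightarrow> real"
  where "m \<le> 2 * (t + 1) ^ (CARD('n) - 2)" "\<And>k. k < m \<Longrightarrow> \<phi> k \<in> Harm t"
    "\<And>a. \<forall>x. (\<Sum>k<m. a k * \<phi> k x) = 0 \<Longrightarrow> \<forall>k<m. a k = 0"
    "\<And>f. f \<in> Harm t \<Longrightarrow> \<exists>a. \<forall>x. f x = (\<Sum>k<m. a k * \<phi> k x)"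
proof -
  define free where "free = (\<lambda>m (\<phi> :: nat \<Rightarrow> real ^ 'n \<Rightarrow> real). (\<forall>k<m. \<phi> k \<in> Harm t) \<and>
      (\<forall>a. (\<forall>x. (\<Sum>k<m. a k * \<phi> k x) = 0) \<longrightarrow> (\<forall>k<m. a k = 0)))"
  have le: "m \<le> 2 * (t + 1) ^ (CARD('n) - 2)" if free: "free m \<phi>" for m \<phi>
  proof (rule ccontr)
    assume "\<not> ?thesis"
    then obtain a where "\<exists>k<m. a k \<noteq> 0" "\<forall>x. (\<Sum>k<m. a k * \<phi> k x) = 0"
      using Harm_dependent[OF n, of m \<phi> t] free by (auto simp: free_def)
    then show False using free by (auto simp: free_def)
  qed
  define M where "M = {m. \<exists>\<phi>. free m \<phi>}"
  have "finite M" by (rule finite_subset[of _ "{..2 * (t + 1) ^ (CARD('n) - 2)}"]) (use le in \<open>auto simp: M_def\<close>)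
  moreover have "0 \<in> M" by (simp add: M_def free_def)
  ultimately have "Max M \<in> M" and max: "k \<in> M \<Longrightarrow> k \<le> Max M" for k by (auto intro: Max_in)
  define m where "m = Max M"
  obtain \<phi> where \<phi>: "free m \<phi>" using \<open>Max M \<in> M\<close> by (auto simp: M_def m_def)
  show thesis
  proof (rule that[of m \<phi>])
    show "m \<le> 2 * (t + 1) ^ (CARD('n) - 2)" by (rule le[OF \<phi>])
    show "\<phi> k \<in> Harm t" if "k < m" for k using \<phi> that by (simp add: free_def)
    show "\<forall>k<m. a k = 0" if "\<forall>x. (\<Sum>k<m. a k * \<phi> k x) = 0" for a
      using \<phi> that by (simp add: free_def)
    fix f :: "real ^ 'n \<Rightarrow> real" assume f: "f \<in> Harm t"
    have "\<not> free (Suc m) (\<phi>(m := f))" using max[of "Suc m"] by (auto simp: M_def m_def)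
    moreover have "(\<phi>(m := f)) k \<in> Harm t" if "k < Suc m" for k
      using \<phi> f that by (auto simp: free_def less_Suc_eq)
    ultimately obtain a k where ak: "k < Suc m" "a k \<noteq> 0" and "\<And>x. (\<Sum>k<Suc m. a k * (\<phi>(m := f)) k x) = 0"
      unfolding free_def by blast
    moreover have "(\<Sum>k<m. a k * (\<phi>(m := f)) k x) = (\<Sum>k<m. a k * \<phi> k x)" for x
      by (rule sum.cong) auto
    ultimately have a: "(\<Sum>k<m. a k * \<phi> k x) + a m * f x = 0" for x by simp
    have "a m \<noteq> 0"
    proof
      assume "a m = 0"
      then have "\<forall>k<m. a k = 0" using \<phi> a by (simp add: free_def)
      then show False using ak \<open>a m = 0\<close> by (auto simp: less_Suc_eq)
    qed
    have "f x = (\<Sum>k<m. (- a k / a m) * \<phi> k x)" for x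
    proof -
      have "f x = - (\<Sum>k<m. a k * \<phi> k x) / a m" using a[of x] \<open>a m \<noteq> 0\<close> by (simp add: field_simps)
      then show ?thesis by (simp add: sum_negf sum_divide_distrib)
    qed
    then show "\<exists>a. \<forall>x. f x = (\<Sum>k<m. a k * \<phi> k x)" by (intro exI[of _ "\<lambda>k. - a k / a m"] allI)
  qed
qed

theorem corollary2p1:
  assumes "CARD('n::finite) \<ge> 2"
  shows "\<exists>C::real. C > 0 \<and>
    (\<forall>(t::nat) (N::nat). t \<ge> 1 \<longrightarrow> real N > C * real t ^ (CARD('n) - 2) \<longrightarrow>
       (\<exists>X :: (real ^ 'n) set. harmonic_index_design t X \<and> card X = N))"
proof -
  define d where "d = CARD('n) - 2"
  define K where "K = harnack_const CARD('n)"
  have K: "K \<ge> 0" by (simp add: K_def harnack_const_def)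
  \<comment> \<open>From \<open>t + 1 \<le> 2 * t\<close> one gets
    \<open>m \<le> 2 * 2 ^ d * t ^ d\<close>; both additive ones in
    \<open>(m + 1) * (K + 1) + 1\<close> are absorbed by \<open>t ^ d \<ge> 1\<close>.\<close>
  define C where "C = (2 * 2 ^ d + 1) * (K + 1) + 1"
  have C: "C > 0" using K by (simp add: C_def add_nonneg_pos)
  have "\<exists>X :: (real ^ 'n) set. harmonic_index_design t X \<and> card X = N"
    if t: "t \<ge> 1" and N: "real N > C * real t ^ d" for t N
  proof -
    obtain m and \<phi> :: "nat \<Rightarrow> real ^ 'n \<Rightarrow> real" where m: "m \<le> 2 * (t + 1) ^ (CARD('n) - 2)"
      and \<phi>: "\<And>k. k < m \<Longrightarrow> \<phi> k \<in> Harm t"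
      and indep: "\<And>a. \<forall>x. (\<Sum>k<m. a k * \<phi> k x) = 0 \<Longrightarrow> \<forall>k<m. a k = 0"
      and span: "\<And>f. f \<in> Harm t \<Longrightarrow> \<exists>a. \<forall>x. f x = (\<Sum>k<m. a k * \<phi> k x)"
      by (rule Harm_basis[OF assms, of t]) (rule that)
    have comb: "(\<lambda>x. \<Sum>k<m. v k * \<phi> k x) \<in> Harm t" for v
      by (rule Harm_sum) (use \<phi> in auto)
    have "\<exists>X. finite X \<and> card X = N \<and> X \<subseteq> sphere 0 1 \<and> (\<forall>i<m. (\<Sum>x\<in>X. \<phi> i x) = 0)"
    proof (rule equal_weight_points_on_sphere[OF assms, where K = K])
      show "continuous_on (sphere 0 1) (\<phi> i)" if "i < m" for i
        using continuous_on_polynomial[OF homogeneous_polynomial_imp_polynomial continuous_on_id] \<phi>[OF that]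
        by (auto simp: Harm_def)
      show "- (K * b) \<le> (\<Sum>i<m. v i * \<phi> i x)"
        if "b \<ge> 0" "\<And>x. norm x = 1 \<Longrightarrow> (\<Sum>i<m. v i * \<phi> i x) \<le> b" "norm x = 1" for v b x
        unfolding K_def by (rule Harm_lower_bound[OF comb t]) (use that in auto)
      show "\<forall>i<m. v i = 0" if "\<And>x. norm x = 1 \<Longrightarrow> (\<Sum>i<m. v i * \<phi> i x) = 0" for v
        using Harm_eq_0_if_sphere_0[OF comb t] that by (intro indep) blast
      show "K \<ge> 0" by (rule K)
      have td: "1 \<le> real t ^ d" using t by (simp add: one_le_power)
      have "real (t + 1) ^ d \<le> (2 * real t) ^ d" using t by (intro power_mono) auto
      then have "real m \<le> 2 * (2 ^ d * real t ^ d)"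
        using of_nat_mono[OF m, where 'a = real] by (simp add: power_mult_distrib flip: d_def)
      then have "real m + 1 \<le> (2 * 2 ^ d + 1) * real t ^ d" using td by (simp add: distrib_right)
      then have "(real m + 1) * (K + 1) \<le> (2 * 2 ^ d + 1) * real t ^ d * (K + 1)"
        using K by (intro mult_right_mono) auto
      then have "(real m + 1) * (K + 1) + 1 \<le> (2 * 2 ^ d + 1) * real t ^ d * (K + 1) + real t ^ d"
        using td by linarith
      also have "\<dots> = C * real t ^ d" by (simp add: C_def algebra_simps)
      finally show "(real m + 1) * (K + 1) + 1 \<le> real N" using N by simp
    qed
    then obtain X where X: "finite X" "card X = N" "X \<subseteq> sphere 0 1" "\<And>i. i < m \<Longrightarrow> (\<Sum>x\<in>X. \<phi> i x) = 0"
      by blast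
    have "0 \<le> C * real t ^ d" using C by simp
    then have "N > 0" using N by simp
    then have "X \<noteq> {}" using X(2) by auto
    moreover have "(\<Sum>x\<in>X. f x) = 0" if f: "f \<in> Harm t" for f
    proof -
      obtain a where "\<And>x. f x = (\<Sum>k<m. a k * \<phi> k x)" using span[OF f] by blast
      then have "(\<Sum>x\<in>X. f x) = (\<Sum>k<m. a k * (\<Sum>x\<in>X. \<phi> k x))"
        by (simp add: sum_distrib_left) (rule sum.swap)
      then show ?thesis using X(4) by simp
    qed
    ultimately have "harmonic_index_design t X"
      using X by (simp add: harmonic_index_design_def)
    then show ?thesis using X(2) by blast
  qed
  then show ?thesis using C unfolding d_def by blast
qed

end
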